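(* Let $\alpha>0$, $t>0$. The monic orthogonal polynomials $P_n(z)=P_n(z,t)$, $n=0,1,2,\ldots$, for the weight $w(x,t)=(1-x^2)^\alpha e^{-t/(1-x^2)}$ on $[-1,1]$ satisfy the second-order differential equation (primes denote $d/dz$) $$P_n''(z)-\left(\mathrm v'(z)+\frac{A_n'(z)}{A_n(z)}\right)P_n'(z)+\left(B_n'(z)-B_n(z)\frac{A_n'(z)}{A_n(z)}+\sum_{j=0}^{n-1}A_j(z)\right)P_n(z)=0,$$ where $$A_n(z)=\frac{2n+1+2\alpha}{1-z^2}+\frac{2n+1+2t-(2n+3+2\alpha)(\beta_n+\beta_{n+1})+4\mathrm p(n,t)}{(1-z^2)^2},$$ $$B_n(z)=\frac{nz}{1-z^2}+\frac{z\left[n-(2n+1+2\alpha)\beta_n+2\mathrm p(n,t)\right]}{(1-z^2)^2},$$ $$\sum_{j=0}^{n-1}A_j(z)=\frac{n^2+2n\alpha}{1-z^2}+\frac{n(n+2t)-(2n+1+2\alpha)\beta_n+4(n+\alpha)\mathrm p(n,t)}{(1-z^2)^2},$$ $$\mathrm v'(z)=\frac{2\alpha z}{1-z^2}+\frac{2tz}{(1-z^2)^2}.$$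
   Context: Fix $\alpha>0$, $t>0$ and $w(x)=w(x,t):=(1-x^2)^\alpha e^{-t/(1-x^2)}$, $x\in[-1,1]$; $\mathrm v(z):=-\ln w(z)=\frac{t}{1-z^2}-\alpha\ln(1-z^2)$. Let $P_n(x,t)$, $n=0,1,2,\ldots$, be the monic polynomials of degree $n$ with $\int_{-1}^1 P_mP_n w\,dx=h_n(t)\delta_{mn}$. Since $w$ is even, $P_n(x,t)=x^n+\mathrm p(n,t)x^{n-2}+\cdots$ (with $\mathrm p(0,t)=\mathrm p(1,t)=0$) and $xP_n=P_{n+1}+\beta_nP_{n-1}$ with $P_0=1$, $P_{-1}=0$, $\beta_n=\beta_n(t)=h_n/h_{n-1}$ for $n\ge1$, $\beta_0=0$. The functions $A_n$, $B_n$ are originally defined by $$A_n(z):=\frac1{h_n}\int_{-1}^1\frac{\mathrm v'(z)-\mathrm v'(y)}{z-y}P_n^2(y)w(y)\,dy,\qquad B_n(z):=\frac1{h_{n-1}}\int_{-1}^1\frac{\mathrm v'(z)-\mathrm v'(y)}{z-y}P_n(y)P_{n-1}(y)w(y)\,dy,$$ with $B_0=0$. *)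

theory Defs
  imports "HOL-Complex_Analysis.Complex_Analysis" "HOL-Computational_Algebra.Polynomial"
begin

text \<open>At \<open>x = 1\<close> and \<open>x = -1\<close> the conventions \<open>u / 0 = 0\<close> and \<open>0 powr \<alpha> = 0\<close> give the value 0,
  which is the limit of the weight there.\<close>

definition weight :: "real \<Rightarrow> real \<Rightarrow> real \<Rightarrow> real" where
  "weight \<alpha> t x = (1 - x\<^sup>2) powr \<alpha> * exp (- t / (1 - x\<^sup>2))"

text \<open>The potential \<open>v = - ln w\<close>, continued from \<open>{-1<..<1}\<close>, is multivalued on the complex plane
  without the points 1 and -1. This is a branch of \<open>t / (1 - z\<^sup>2) - \<alpha> ln (1 - z\<^sup>2)\<close> that is
  holomorphic near \<open>z0\<close>; the principal branch is discontinuous at the real points outside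
  \<open>{-1..1}\<close>. Different branches of the logarithm differ by constants, so \<open>v_deriv\<close>, the
  derivative \<open>v'\<close>, does not depend on the choice.\<close>

definition v_branch :: "real \<Rightarrow> real \<Rightarrow> complex \<Rightarrow> complex \<Rightarrow> complex" where
  "v_branch \<alpha> t z0 z =
     of_real t / (1 - z\<^sup>2) - of_real \<alpha> * (Ln (1 - z0\<^sup>2) + Ln ((1 - z\<^sup>2) / (1 - z0\<^sup>2)))"

definition v_deriv :: "real \<Rightarrow> real \<Rightarrow> complex \<Rightarrow> complex" where
  "v_deriv \<alpha> t z = deriv (v_branch \<alpha> t z) z"

lemma v_branch_differentiable:
  assumes "z\<^sup>2 \<noteq> 1"
  shows "v_branch \<alpha> t z field_differentiable at z"
  unfolding v_branch_def field_differentiable_def using assms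
  by (auto intro!: exI derivative_eq_intros refl)

lemma v_branch_of_real:
  assumes "\<bar>x0\<bar> < 1" "\<bar>x\<bar> < 1"
  shows "v_branch \<alpha> t (of_real x0) (of_real x) = of_real (- ln (weight \<alpha> t x))"
proof -
  have p: "1 - x0\<^sup>2 > 0" "1 - x\<^sup>2 > 0"
    using assms by (simp_all add: abs_square_less_1)
  have 1: "Ln (1 - (of_real x0)\<^sup>2) = of_real (ln (1 - x0\<^sup>2))"
    using Ln_of_real[OF p(1)] by simp
  have "(1 - x\<^sup>2) / (1 - x0\<^sup>2) > 0" using p by simp
  from Ln_of_real[OF this]
  have 2: "Ln ((1 - (of_real x)\<^sup>2) / (1 - (of_real x0)\<^sup>2)) = of_real (ln ((1 - x\<^sup>2) / (1 - x0\<^sup>2)))"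
    by simp
  have 3: "ln (weight \<alpha> t x) = \<alpha> * ln (1 - x\<^sup>2) - t / (1 - x\<^sup>2)"
    using p by (simp add: weight_def ln_mult ln_powr)
  show ?thesis
    using p unfolding v_branch_def 1 2 3 by (simp add: ln_div)
qed

text \<open>\<open>P\<close> is the sequence of monic polynomials, \<open>P n\<close> of degree \<open>n\<close>, orthogonal on \<open>{-1..1}\<close> for
  the weight \<open>w\<close>.\<close>

definition monic_orthogonal :: "(real \<Rightarrow> real) \<Rightarrow> (nat \<Rightarrow> real poly) \<Rightarrow> bool" where
  "monic_orthogonal w P \<longleftrightarrow>
     (\<forall>n. degree (P n) = n \<and> lead_coeff (P n) = 1) \<and>
     (\<forall>m n. m \<noteq> n \<longrightarrow> integral {-1..1} (\<lambda>x. poly (P m) x * poly (P n) x * w x) = 0)"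

definition sqnorm :: "(real \<Rightarrow> real) \<Rightarrow> (nat \<Rightarrow> real poly) \<Rightarrow> nat \<Rightarrow> real" where
  "sqnorm w P n = integral {-1..1} (\<lambda>x. (poly (P n) x)\<^sup>2 * w x)"

definition beta :: "(real \<Rightarrow> real) \<Rightarrow> (nat \<Rightarrow> real poly) \<Rightarrow> nat \<Rightarrow> real" where
  "beta w P n = (if n = 0 then 0 else sqnorm w P n / sqnorm w P (n - 1))"

definition subcoeff :: "(nat \<Rightarrow> real poly) \<Rightarrow> nat \<Rightarrow> real" where
  "subcoeff P n = (if n < 2 then 0 else coeff (P n) (n - 2))"

definition cpoly :: "real poly \<Rightarrow> complex \<Rightarrow> complex" where
  "cpoly p z = poly (map_poly of_real p) z"

text \<open>For \<open>z \<in> {-1<..<1}\<close> the integrands below have a removable singularity at \<open>y = z\<close>, whose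
  value does not affect the integral.\<close>

definition ladder_A :: "real \<Rightarrow> real \<Rightarrow> (nat \<Rightarrow> real poly) \<Rightarrow> nat \<Rightarrow> complex \<Rightarrow> complex" where
  "ladder_A \<alpha> t P n z =
     1 / of_real (sqnorm (weight \<alpha> t) P n) *
     integral {-1..1} (\<lambda>y::real. (v_deriv \<alpha> t z - v_deriv \<alpha> t (of_real y)) / (z - of_real y) *
       of_real ((poly (P n) y)\<^sup>2 * weight \<alpha> t y))"

definition ladder_B :: "real \<Rightarrow> real \<Rightarrow> (nat \<Rightarrow> real poly) \<Rightarrow> nat \<Rightarrow> complex \<Rightarrow> complex" where
  "ladder_B \<alpha> t P n z = (if n = 0 then 0 else
     1 / of_real (sqnorm (weight \<alpha> t) P (n - 1)) *
     integral {-1..1} (\<lambda>y::real. (v_deriv \<alpha> t z - v_deriv \<alpha> t (of_real y)) / (z - of_real y) *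
       of_real (poly (P n) y * poly (P (n - 1)) y * weight \<alpha> t y)))"

end

theory Submission
  imports Defs "HOL-Real_Asymp.Real_Asymp"
begin

text \<open>
  Since \<open>(1 - x\<^sup>2)\<^sup>2 v'(x)\<close> is a polynomial, everything can be expressed through the single
  functional \<open>M p = \<integral> p w / (1 - y\<^sup>2)\<^sup>2\<close> on polynomials: linearity, evenness, positivity and integration
  by parts are all that is used of the weight. Partial fractions of the divided difference of \<open>v'\<close>
  reduce \<open>A\<^sub>n\<close> and \<open>B\<^sub>n\<close> to a few values of \<open>M\<close>, which integration by parts evaluates. Expanding
  \<open>P\<^sub>n'\<close> in the \<open>P\<^sub>k\<close>, integrating by parts and applying the Christoffel-Darboux formula gives the
  lowering relation \<open>P\<^sub>n' = \<beta>\<^sub>n A\<^sub>n P\<^sub>n\<^sub>-\<^sub>1 - B\<^sub>n P\<^sub>n\<close>. With the explicit formulas,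
  \<open>B\<^sub>n\<^sub>+\<^sub>1 + B\<^sub>n = z A\<^sub>n - v'\<close> is plain algebra; it turns the lowering relation into the raising relation
  \<open>P\<^sub>n\<^sub>-\<^sub>1' = (B\<^sub>n + v') P\<^sub>n\<^sub>-\<^sub>1 - A\<^sub>n\<^sub>-\<^sub>1 P\<^sub>n\<close>. Differentiating the recurrence yields
  \<open>1 + z (B\<^sub>n\<^sub>+\<^sub>1 - B\<^sub>n) = \<beta>\<^sub>n\<^sub>+\<^sub>1 A\<^sub>n\<^sub>+\<^sub>1 - \<beta>\<^sub>n A\<^sub>n\<^sub>-\<^sub>1\<close>, and multiplying this by \<open>A\<^sub>n\<close> makes it telescope to
  \<open>B\<^sub>n\<^sup>2 + v' B\<^sub>n + \<Sum> A\<^sub>j = \<beta>\<^sub>n A\<^sub>n A\<^sub>n\<^sub>-\<^sub>1\<close>. Eliminating \<open>P\<^sub>n\<^sub>-\<^sub>1\<close> from the two ladder relations gives the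
  differential equation.
\<close>

subsection \<open>Orthogonal polynomials of an even functional\<close>

lemma poly_ext: "(\<And>x. poly p x = poly q x) \<Longrightarrow> p = (q :: real poly)"
  using poly_eq_poly_eq_iff by blast

abbreviation one_minus_sq :: "real poly" where
  "one_minus_sq \<equiv> [:1, 0, -1:]"

lemma poly_X: "poly [:0, 1:] x = (x :: real)"
  and poly_one_minus_sq: "poly one_minus_sq x = 1 - x\<^sup>2"
  by (simp_all add: power2_eq_square)

lemmas poly_eval = poly_mult poly_add poly_diff poly_smult poly_power poly_0 poly_X poly_one_minus_sq

text \<open>\<open>M\<close> stands for integration against \<open>w / (1 - y\<^sup>2)\<^sup>2\<close>, so that \<open>one_minus_sq\<^sup>2\<close> restores the weight
  \<open>w\<close>, and the polynomial in the assumption \<open>M_by_parts\<close> is \<open>(1 - y\<^sup>2)\<^sup>2 v'(y)\<close>.\<close>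

locale even_weight_functional =
  fixes \<alpha> t :: real and M :: "real poly \<Rightarrow> real" and P :: "nat \<Rightarrow> real poly"
  assumes M_add: "M (p + q) = M p + M q"
    and M_smult: "M (smult c p) = c * M p"
    and M_reflect: "M (pcompose p [:0, -1:]) = M p"
    and M_by_parts: "M (one_minus_sq\<^sup>2 * pderiv p) = M ([:0, 2 * \<alpha> + 2 * t, 0, - 2 * \<alpha>:] * p)"
    and M_pos: "p \<noteq> 0 \<Longrightarrow> M (one_minus_sq\<^sup>2 * p\<^sup>2) > 0"
    and degree_P: "degree (P n) = n"
    and lead_P: "lead_coeff (P n) = 1"
    and orth_P: "m \<noteq> n \<Longrightarrow> M (one_minus_sq\<^sup>2 * (P m * P n)) = 0"
begin

definition L :: "real poly \<Rightarrow> real" where "L p = M (one_minus_sq\<^sup>2 * p)"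

definition h :: "nat \<Rightarrow> real" where "h n = L ((P n)\<^sup>2)"

definition \<beta> :: "nat \<Rightarrow> real" where "\<beta> n = (if n = 0 then 0 else h n / h (n - 1))"

abbreviation \<sigma> :: "nat \<Rightarrow> real" where "\<sigma> n \<equiv> subcoeff P n"

definition V :: "real poly" where "V = [:0, 2 * \<alpha> + 2 * t, 0, - 2 * \<alpha>:]"

section \<open>Linearity, parity and positivity of the functionals\<close>

lemma M_0: "M 0 = 0"
  using M_smult[of 0 0] by simp

lemma M_diff: "M (p - q) = M p - M q"
  using M_add[of "p - q" q] by simp

lemma L_add: "L (p + q) = L p + L q"
  by (simp only: L_def distrib_left M_add)

lemma L_smult: "L (smult c p) = c * L p"
  by (simp only: L_def mult_smult_right M_smult)

lemma L_diff: "L (p - q) = L p - L q"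
  by (simp only: L_def right_diff_distrib M_diff)

lemma L_0: "L 0 = 0"
  by (simp add: L_def M_0)

lemma L_sum: "L (\<Sum>i\<in>A. f i) = (\<Sum>i\<in>A. L (f i))"
  by (induction A rule: infinite_finite_induct) (simp_all add: L_0 L_add)

lemma M_sum: "M (\<Sum>i\<in>A. f i) = (\<Sum>i\<in>A. M (f i))"
  by (induction A rule: infinite_finite_induct) (simp_all add: M_0 M_add)

lemma L_reflect: "L (pcompose p [:0, -1:]) = L p"
proof -
  have "one_minus_sq\<^sup>2 * pcompose p [:0, -1:] = pcompose (one_minus_sq\<^sup>2 * p) [:0, -1:]"
    by (intro poly_ext) (simp add: poly_pcompose)
  then show ?thesis unfolding L_def by (simp only: M_reflect)
qed

lemma L_by_parts: "L (pderiv p) = M (V * p)"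
  unfolding L_def V_def by (rule M_by_parts)

lemma L_square_eq_0: "L (p\<^sup>2) = 0 \<Longrightarrow> p = 0"
  using M_pos[of p] by (force simp: L_def)

lemma P_nonzero: "P n \<noteq> 0"
  using lead_P[of n] by auto

lemma h_pos: "h n > 0"
  unfolding h_def L_def using M_pos P_nonzero by blast

lemma h_nonzero: "h n \<noteq> 0"
  using h_pos[of n] by simp

lemma \<beta>_0 [simp]: "\<beta> 0 = 0"
  by (simp add: \<beta>_def)

lemma h_Suc: "h (Suc n) = \<beta> (Suc n) * h n"
  using h_nonzero[of n] by (simp add: \<beta>_def)

lemma coeff_P [simp]: "coeff (P n) n = 1"
  using lead_P[of n] by (simp add: degree_P)

lemma coeff_P_gt [simp]: "i > n \<Longrightarrow> coeff (P n) i = 0"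
  by (simp add: coeff_eq_0 degree_P)

lemma P_0: "P 0 = 1"
  using degree_P[of 0] coeff_P[of 0] by (metis degree_0_id one_pCons)

section \<open>Orthogonality and expansions in the P_k\<close>

lemma orth_L: "m \<noteq> n \<Longrightarrow> L (P m * P n) = 0"
  unfolding L_def by (rule orth_P)

text \<open>Subtracting the multiple of the monic \<open>P n\<close> that cancels degree
  \<open>n\<close> lowers the bound. Bounding by vanishing coefficients instead of
  \<open>degree\<close> lets the induction start at \<open>q = 0\<close>.\<close>

lemma poly_expansion:
  assumes "\<And>i. i \<ge> n \<Longrightarrow> coeff q i = 0"
  shows "\<exists>c. q = (\<Sum>k<n. smult (c k) (P k))"
  using assms
proof (induction n arbitrary: q)
  case 0
  then have "q = 0" by (intro poly_eqI) simp
  then show ?case by simp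
next
  case (Suc n)
  have "coeff (q - smult (coeff q n) (P n)) i = 0" if "i \<ge> n" for i
    using that Suc.prems[of i] by (cases "i = n") auto
  from Suc.IH[OF this] obtain c where
    c: "q - smult (coeff q n) (P n) = (\<Sum>k<n. smult (c k) (P k))" by auto
  have "q = (\<Sum>k<n. smult ((c(n := coeff q n)) k) (P k)) + smult (coeff q n) (P n)"
    using c by (simp add: algebra_simps)
  also have "\<dots> = (\<Sum>k<Suc n. smult ((c(n := coeff q n)) k) (P k))" by simp
  finally show ?case by blast
qed

lemma fourier_expansion:
  assumes "\<And>i. i \<ge> n \<Longrightarrow> coeff q i = 0"
  shows "q = (\<Sum>k<n. smult (L (q * P k) / h k) (P k))"
proof -
  obtain c where c: "q = (\<Sum>k<n. smult (c k) (P k))"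
    using poly_expansion[OF assms] by auto
  have "L (q * P k) / h k = c k" if "k < n" for k
  proof -
    have "L (q * P k) = (\<Sum>j<n. c j * L (P j * P k))"
      by (subst c) (simp add: sum_distrib_right L_sum L_smult)
    also have "\<dots> = (\<Sum>j<n. if j = k then c j * h k else 0)"
      by (intro sum.cong) (auto simp: orth_L h_def power2_eq_square)
    also have "\<dots> = c k * h k" using that by simp
    finally show ?thesis using h_nonzero by simp
  qed
  then show ?thesis by (subst c) (intro sum.cong, auto)
qed

lemma L_P_mult_low:
  assumes "\<And>i. i \<ge> n \<Longrightarrow> coeff q i = 0"
  shows "L (P n * q) = 0"
proof -
  obtain c where c: "q = (\<Sum>k<n. smult (c k) (P k))"
    using poly_expansion[OF assms] by auto
  have "L (P n * q) = (\<Sum>k<n. c k * L (P n * P k))"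
    by (subst c) (simp add: sum_distrib_left L_sum L_smult)
  then show ?thesis by (simp add: orth_L)
qed

text \<open>Removing \<open>coeff q n\<close> copies of \<open>P n\<close> leaves a polynomial
  orthogonal to \<open>P n\<close>. Integrals below are thereby reduced to reading off a top
  coefficient.\<close>

lemma L_P_mult:
  assumes "\<And>i. i > n \<Longrightarrow> coeff q i = 0"
  shows "L (P n * q) = coeff q n * h n"
proof -
  have "L (P n * (q - smult (coeff q n) (P n))) = 0"
  proof (rule L_P_mult_low)
    show "coeff (q - smult (coeff q n) (P n)) i = 0" if "i \<ge> n" for i
      using that assms[of i] by (cases "i = n") auto
  qed
  then show ?thesis
    by (simp add: right_diff_distrib L_diff L_smult h_def power2_eq_square)
qed

section \<open>Parity and three-term recurrence\<close>

lemma P_reflect: "pcompose (P n) [:0, -1:] = smult ((-1) ^ n) (P n)"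
proof -
  \<comment> \<open>\<open>D\<close> has no coefficients from degree \<open>n\<close> on, both terms
    being monic. \<open>P n\<close> and its reflection are orthogonal to such polynomials, the
    latter because the reflection can be moved onto \<open>D\<close>; hence
    \<open>L (D\<^sup>2) = 0\<close>.\<close>
  define D where "D = smult ((-1) ^ n) (pcompose (P n) [:0, -1:]) - P n"
  have co: "coeff (pcompose q [:0, -1:]) i = (-1) ^ i * coeff q i" for q :: "real poly" and i
    by (simp add: coeff_pcompose_linear)
  have lowD: "coeff D i = 0" if "i \<ge> n" for i
    using that by (cases "i = n") (auto simp: D_def co simp flip: power_mult_distrib)
  have "L (pcompose (P n) [:0, -1:] * D) = L (pcompose (P n * pcompose D [:0, -1:]) [:0, -1:])"
    by (rule arg_cong[of _ _ L], rule poly_ext) (simp add: poly_pcompose)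
  also have "\<dots> = 0"
    unfolding L_reflect by (rule L_P_mult_low) (simp add: co lowD)
  finally have "L (D\<^sup>2) = 0"
    using L_P_mult_low[of n D, OF lowD]
    by (simp add: power2_eq_square) (subst (1) D_def, simp add: left_diff_distrib L_diff L_smult)
  then have "D = 0" by (rule L_square_eq_0)
  then have "smult ((-1) ^ n) (smult ((-1) ^ n) (pcompose (P n) [:0, -1:])) = smult ((-1) ^ n) (P n)"
    by (simp add: D_def)
  then show ?thesis by (simp flip: power_mult_distrib)
qed

lemma coeff_P_Suc [simp]: "coeff (P (Suc n)) n = 0"
proof -
  have "coeff (pcompose (P (Suc n)) [:0, -1:]) n = (-1) ^ n * coeff (P (Suc n)) n"
    by (simp add: coeff_pcompose_linear)
  then show ?thesis unfolding P_reflect by simp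
qed

text \<open>The defect \<open>D\<close> has no coefficients from degree \<open>n\<close> on:
  monicity settles degree n + 1, parity degree n. It then suffices that
  \<open>L (D\<^sup>2) = 0\<close>. At n = 0 the truncated \<open>n - 1\<close> is harmless because
  \<open>\<beta> 0 = 0\<close>.\<close>

lemma recurrence: "pCons 0 (P n) = P (Suc n) + smult (\<beta> n) (P (n - 1))"
proof -
  define D where "D = pCons 0 (P n) - P (Suc n) - smult (\<beta> n) (P (n - 1))"
  have low: "coeff D i = 0" if "i \<ge> n" for i
  proof -
    consider "i = n" | "i = Suc n" | "i > Suc n" using \<open>i \<ge> n\<close> by linarith
    then show ?thesis
    proof cases
      case 1
      then show ?thesis by (cases n) (auto simp: D_def coeff_pCons)
    qed (auto simp: D_def coeff_pCons split: nat.split)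
  qed
  have "L (D\<^sup>2) = L (P n * pCons 0 D - P (Suc n) * D - smult (\<beta> n) (P (n - 1) * D))"
    by (rule arg_cong[of _ _ L], rule poly_ext) (simp add: D_def power2_eq_square algebra_simps)
  also have "\<dots> = L (P n * pCons 0 D) - L (P (Suc n) * D) - \<beta> n * L (P (n - 1) * D)"
    by (simp only: L_diff L_smult)
  also have "L (P (Suc n) * D) = 0"
    by (rule L_P_mult_low) (simp add: low)
  also have "L (P n * pCons 0 D) = coeff (pCons 0 D) n * h n"
    by (rule L_P_mult) (use low in \<open>auto simp: coeff_pCons split: nat.split\<close>)
  \<comment> \<open>For n > 0 both terms equal \<open>coeff D (n - 1) * h n\<close>.\<close>
  also have "coeff (pCons 0 D) n * h n - 0 - \<beta> n * L (P (n - 1) * D) = 0"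
  proof (cases n)
    case (Suc m)
    have "L (P m * D) = coeff D m * h m"
      by (rule L_P_mult) (use low Suc in auto)
    then show ?thesis by (simp add: Suc h_Suc)
  qed simp
  finally have "D = 0" by (rule L_square_eq_0)
  then show ?thesis by (simp add: D_def algebra_simps)
qed

text \<open>Comparison of the coefficients of degree n - 1 in the recurrence.\<close>

lemma subcoeff_Suc: "\<sigma> (Suc n) = \<sigma> n - \<beta> n"
proof (cases n)
  case 0
  then show ?thesis by (simp add: subcoeff_def)
next
  case (Suc m)
  have "coeff (pCons 0 (P n)) m = coeff (P (Suc n) + smult (\<beta> n) (P (n - 1))) m"
    by (simp only: recurrence)
  then show ?thesis
    by (cases m) (auto simp: Suc subcoeff_def coeff_pCons eval_nat_numeral)
qed

lemma poly_P_reflect: "poly (P n) (- x) = (-1) ^ n * poly (P n) x"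
  using arg_cong[OF P_reflect[of n], of "\<lambda>p. poly p x"] by (simp add: poly_pcompose)

lemma poly_recurrence: "x * poly (P n) x = poly (P (Suc n)) x + \<beta> n * poly (P (n - 1)) x"
  using arg_cong[OF recurrence[of n], of "\<lambda>p. poly p x"] by simp

lemma M_odd:
  assumes "\<And>x. poly f (- x) = - poly f x"
  shows "M f = 0"
proof -
  have "pcompose f [:0, -1:] = smult (-1) f"
    by (rule poly_ext) (simp add: poly_pcompose assms)
  then show ?thesis using M_reflect[of f] by (simp only: M_smult)
qed

section \<open>Integrals of P_m P_n and P_m P_n' against powers of x\<close>

lemma L_X2_P_P: "L ([:0, 1:]\<^sup>2 * (P n)\<^sup>2) = (\<beta> n + \<beta> (Suc n)) * h n"
proof -
  \<comment> \<open>The square of the recurrence; orthogonality will kill the cross term.\<close>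
  have "[:0, 1:]\<^sup>2 * (P n)\<^sup>2 = P (Suc n) * P (Suc n) + smult (2 * \<beta> n) (P (Suc n) * P (n - 1))
          + smult ((\<beta> n)\<^sup>2) ((P (n - 1))\<^sup>2)"
  proof (rule poly_ext)
    fix x
    have "poly ([:0, 1:]\<^sup>2 * (P n)\<^sup>2) x = (x * poly (P n) x)\<^sup>2"
      by (simp add: power_mult_distrib)
    then show "poly ([:0, 1:]\<^sup>2 * (P n)\<^sup>2) x = poly (P (Suc n) * P (Suc n)
        + smult (2 * \<beta> n) (P (Suc n) * P (n - 1)) + smult ((\<beta> n)\<^sup>2) ((P (n - 1))\<^sup>2)) x"
      unfolding poly_recurrence by (simp add: power2_eq_square algebra_simps)
  qed
  then have "L ([:0, 1:]\<^sup>2 * (P n)\<^sup>2) = h (Suc n) + 2 * \<beta> n * 0 + (\<beta> n)\<^sup>2 * h (n - 1)"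
    by (simp only: L_add L_smult h_def power2_eq_square orth_L[of "Suc n" "n - 1"])
  moreover have "(\<beta> n)\<^sup>2 * h (n - 1) = \<beta> n * h n"
    by (cases n) (simp_all add: h_Suc power2_eq_square)
  ultimately show ?thesis by (simp add: h_Suc algebra_simps)
qed

text \<open>The Euler operator x d/dx multiplies x^i by i, so subtracting n P_n removes the top
  coefficient. By parity the remainder has degree at most n - 2, with coefficient -2
  \<open>\<sigma> n\<close> there.\<close>

definition euler_rest :: "nat \<Rightarrow> real poly" where
  "euler_rest n = [:0, 1:] * pderiv (P n) - smult (real n) (P n)"

lemma coeff_euler_rest: "coeff (euler_rest n) i = (real i - real n) * coeff (P n) i"
  by (cases i) (simp_all add: euler_rest_def coeff_pderiv algebra_simps)

lemma coeff_euler_rest_0: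
  assumes "Suc i \<ge> n"
  shows "coeff (euler_rest n) i = 0"
proof -
  consider "n = Suc i" | "i = n" | "i > n" using assms by linarith
  then show ?thesis by cases (auto simp: coeff_euler_rest)
qed

lemma coeff_X2_euler_rest: "coeff (pCons 0 (pCons 0 (euler_rest n))) n = - 2 * \<sigma> n"
  by (auto simp: coeff_pCons subcoeff_def coeff_euler_rest eval_nat_numeral split: nat.split)

lemma L_X_P_pderiv: "L (P n * ([:0, 1:] * pderiv (P n))) = real n * h n"
proof -
  have eq: "[:0, 1:] * pderiv (P n) = smult (real n) (P n) + euler_rest n"
    by (simp add: euler_rest_def)
  have "L (P n * euler_rest n) = 0"
    by (rule L_P_mult_low) (simp add: coeff_euler_rest_0)
  then show ?thesis
    unfolding eq by (simp only: distrib_left mult_smult_right L_add L_smult h_def power2_eq_square)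
qed

lemma L_X3_P_pderiv:
  "L (P n * ([:0, 1:] ^ 3 * pderiv (P n))) = (real n * (\<beta> n + \<beta> (Suc n)) - 2 * \<sigma> n) * h n"
proof -
  have eq: "P n * ([:0, 1:] ^ 3 * pderiv (P n)) = smult (real n) ([:0, 1:]\<^sup>2 * (P n)\<^sup>2)
          + P n * pCons 0 (pCons 0 (euler_rest n))"
    by (rule poly_ext) (simp add: euler_rest_def eval_nat_numeral algebra_simps)
  have "L (P n * pCons 0 (pCons 0 (euler_rest n))) = - 2 * \<sigma> n * h n"
    unfolding coeff_X2_euler_rest[symmetric]
    by (rule L_P_mult) (auto simp: coeff_pCons coeff_euler_rest_0 split: nat.split)
  then show ?thesis
    unfolding eq by (simp only: L_add L_smult L_X2_P_P) (simp add: algebra_simps)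
qed

lemma L_X_P_P_Suc: "L ([:0, 1:] * (P (Suc n) * P n)) = \<beta> (Suc n) * h n"
proof -
  have "L ([:0, 1:] * (P (Suc n) * P n)) = L (P (Suc n) * pCons 0 (P n))"
    by (rule arg_cong[of _ _ L], rule poly_ext) simp
  also have "\<dots> = coeff (pCons 0 (P n)) (Suc n) * h (Suc n)"
    by (rule L_P_mult) (auto simp: coeff_pCons split: nat.split)
  finally show ?thesis by (simp add: h_Suc)
qed

lemma L_P_pderiv_Suc: "L (P n * pderiv (P (Suc n))) = real (Suc n) * h n"
proof -
  have "L (P n * pderiv (P (Suc n))) = coeff (pderiv (P (Suc n))) n * h n"
    by (rule L_P_mult) (simp add: coeff_pderiv)
  then show ?thesis by (simp add: coeff_pderiv)
qed

lemma L_X2_P_pderiv_Suc: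
  "L (P n * ([:0, 1:]\<^sup>2 * pderiv (P (Suc n)))) = (real (Suc n) * \<beta> (Suc n) - 2 * \<sigma> (Suc n)) * h n"
proof -
  have eq: "P n * ([:0, 1:]\<^sup>2 * pderiv (P (Suc n))) =
      smult (real (Suc n)) ([:0, 1:] * (P (Suc n) * P n)) + P n * pCons 0 (euler_rest (Suc n))"
    by (rule poly_ext) (simp add: euler_rest_def eval_nat_numeral algebra_simps)
  have "L (P n * pCons 0 (euler_rest (Suc n))) = coeff (pCons 0 (euler_rest (Suc n))) n * h n"
    by (rule L_P_mult) (auto simp: coeff_pCons coeff_euler_rest_0 split: nat.split)
  also have "coeff (pCons 0 (euler_rest (Suc n))) n = - 2 * \<sigma> (Suc n)"
    using coeff_X2_euler_rest[of "Suc n"] by simp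
  finally show ?thesis
    unfolding eq by (simp only: L_add L_smult L_X_P_P_Suc) (simp add: algebra_simps)
qed

lemma L_P_Suc_pderiv: "L (P (Suc n) * pderiv (P n)) = 0"
  by (rule L_P_mult_low) (simp add: coeff_pderiv)

lemma L_X2_P_Suc_pderiv:
  "L (P (Suc n) * ([:0, 1:]\<^sup>2 * pderiv (P n))) = real n * \<beta> (Suc n) * h n"
proof -
  have eq: "[:0, 1:]\<^sup>2 * pderiv (P n) = pCons 0 (pCons 0 (pderiv (P n)))"
    by (simp add: power2_eq_square)
  have "L (P (Suc n) * pCons 0 (pCons 0 (pderiv (P n))))
      = coeff (pCons 0 (pCons 0 (pderiv (P n)))) (Suc n) * h (Suc n)"
    by (rule L_P_mult) (auto simp: coeff_pCons coeff_pderiv split: nat.split)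
  also have "coeff (pCons 0 (pCons 0 (pderiv (P n)))) (Suc n) = real n"
    by (cases n) (simp_all add: coeff_pderiv)
  finally show ?thesis unfolding eq by (simp add: h_Suc)
qed

subsection \<open>The moments in the ladder coefficients\<close>

text \<open>\<open>a n\<close> and \<open>R n\<close> will be the numerators over 1 - z^2 and (1 -
  z^2)^2 in A_n; z times \<open>r n\<close> will be the one over (1 - z^2)^2 in B_n.\<close>

definition a :: "nat \<Rightarrow> real" where
  "a n = 2 * real n + 1 + 2 * \<alpha>"

definition R :: "nat \<Rightarrow> real" where
  "R n = 2 * real n + 1 + 2 * t - (2 * real n + 3 + 2 * \<alpha>) * (\<beta> n + \<beta> (Suc n)) + 4 * \<sigma> n"

definition r :: "nat \<Rightarrow> real" where
  "r n = real n - (2 * real n + 1 + 2 * \<alpha>) * \<beta> n + 2 * \<sigma> n"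

text \<open>Integration by parts tested on x P_n^2. Since V = 2 \<alpha> x (1 - x^2) + 2 t x, both
  moments appear once x^2 is replaced by 1 - (1 - x^2) in the \<alpha> part, at the cost of an
  \<open>L\<close> value.\<close>

lemma moment_a:
  "2 * \<alpha> * M (one_minus_sq * (P n)\<^sup>2) + 2 * t * M ([:0, 1:]\<^sup>2 * (P n)\<^sup>2) = a n * h n"
proof -
  have 1: "smult (2 * \<alpha>) (one_minus_sq * (P n)\<^sup>2) + smult (2 * t) ([:0, 1:]\<^sup>2 * (P n)\<^sup>2)
      = V * ([:0, 1:] * (P n)\<^sup>2) + smult (2 * \<alpha>) (one_minus_sq\<^sup>2 * (P n)\<^sup>2)"
    by (rule poly_ext) (simp add: V_def power2_eq_square, algebra)
  have 2: "pderiv ([:0, 1:] * (P n)\<^sup>2) = (P n)\<^sup>2 + smult 2 (P n * ([:0, 1:] * pderiv (P n)))"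
    by (rule poly_ext) (simp add: pderiv_mult pderiv_pCons power2_eq_square algebra_simps)
  have "M (V * ([:0, 1:] * (P n)\<^sup>2)) = h n + 2 * (real n * h n)"
    by (simp only: L_by_parts[symmetric] 2 L_add L_smult L_X_P_pderiv h_def)
  then show ?thesis
    using arg_cong[OF 1, of M]
    by (simp only: M_add M_smult L_def[symmetric] h_def[symmetric]) (simp add: a_def algebra_simps)
qed

text \<open>In the test polynomial x (1 - x^2) P_n^2 the extra factor 1 - x^2 turns the \<alpha>
  part into an \<open>L\<close> value, which isolates the t part.\<close>

lemma moment_R: "2 * t * M (one_minus_sq * (P n)\<^sup>2) = R n * h n"
proof -
  let ?q = "[:0, 1:] * (one_minus_sq * (P n)\<^sup>2)"
  have 1: "V * ?q = smult (2 * \<alpha>) (one_minus_sq\<^sup>2 * ([:0, 1:]\<^sup>2 * (P n)\<^sup>2))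
      + smult (2 * t) (one_minus_sq * (P n)\<^sup>2) - smult (2 * t) (one_minus_sq\<^sup>2 * (P n)\<^sup>2)"
    by (rule poly_ext) (simp add: V_def power2_eq_square, algebra)
  have 2: "pderiv ?q = (P n)\<^sup>2 - smult 3 ([:0, 1:]\<^sup>2 * (P n)\<^sup>2)
      + smult 2 (P n * ([:0, 1:] * pderiv (P n))) - smult 2 (P n * ([:0, 1:] ^ 3 * pderiv (P n)))"
    by (simp only: pderiv_mult power2_eq_square, rule poly_ext)
      (simp add: pderiv_pCons eval_nat_numeral algebra_simps)
  have "M (V * ?q) = h n - 3 * ((\<beta> n + \<beta> (Suc n)) * h n) + 2 * (real n * h n)
      - 2 * ((real n * (\<beta> n + \<beta> (Suc n)) - 2 * \<sigma> n) * h n)"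
    by (simp only: L_by_parts[symmetric] 2 L_add L_diff L_smult L_X_P_pderiv L_X3_P_pderiv L_X2_P_P
        h_def)
  moreover have "M (V * ?q) = 2 * \<alpha> * ((\<beta> n + \<beta> (Suc n)) * h n)
      + 2 * t * M (one_minus_sq * (P n)\<^sup>2) - 2 * t * h n"
    by (simp only: 1 M_add M_diff M_smult L_def[symmetric] L_X2_P_P) (simp add: h_def)
  ultimately show ?thesis by (simp add: R_def algebra_simps)
qed

lemma moment_n:
  "2 * \<alpha> * M (one_minus_sq * ([:0, 1:] * (P (Suc n) * P n))) + 2 * t * M ([:0, 1:] * (P (Suc n) * P n))
   = real (Suc n) * h n"
proof -
  let ?f = "P (Suc n) * P n"
  have 1: "smult (2 * \<alpha>) (one_minus_sq * ([:0, 1:] * ?f)) + smult (2 * t) ([:0, 1:] * ?f) = V * ?f"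
    by (rule poly_ext) (simp add: V_def, algebra)
  have 2: "pderiv ?f = P n * pderiv (P (Suc n)) + P (Suc n) * pderiv (P n)"
    by (simp add: pderiv_mult)
  have "M (V * ?f) = real (Suc n) * h n + 0"
    by (simp only: L_by_parts[symmetric] 2 L_add L_P_pderiv_Suc L_P_Suc_pderiv)
  then show ?thesis
    using arg_cong[OF 1, of M] by (simp only: M_add M_smult)
qed

text \<open>As in \<open>moment_R\<close>, a factor 1 - x^2 in the test polynomial isolates the t
  part.\<close>

lemma moment_r: "2 * t * M (one_minus_sq * ([:0, 1:] * (P (Suc n) * P n))) = r (Suc n) * h n"
proof -
  let ?f = "P (Suc n) * P n"
  have 1: "V * (one_minus_sq * ?f) = smult (2 * \<alpha>) (one_minus_sq\<^sup>2 * ([:0, 1:] * ?f))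
      + smult (2 * t) (one_minus_sq * ([:0, 1:] * ?f))"
    by (rule poly_ext) (simp add: V_def power2_eq_square, algebra)
  have 2: "pderiv (one_minus_sq * ?f) = P n * pderiv (P (Suc n))
      - P n * ([:0, 1:]\<^sup>2 * pderiv (P (Suc n))) + P (Suc n) * pderiv (P n)
      - P (Suc n) * ([:0, 1:]\<^sup>2 * pderiv (P n)) - smult 2 ([:0, 1:] * ?f)"
    by (simp only: pderiv_mult power2_eq_square, rule poly_ext)
      (simp add: pderiv_pCons eval_nat_numeral algebra_simps)
  have "M (V * (one_minus_sq * ?f)) = real (Suc n) * h n
      - (real (Suc n) * \<beta> (Suc n) - 2 * \<sigma> (Suc n)) * h n + 0 - real n * \<beta> (Suc n) * h n
      - 2 * (\<beta> (Suc n) * h n)"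
    by (simp only: L_by_parts[symmetric] 2 L_add L_diff L_smult L_P_pderiv_Suc L_P_Suc_pderiv
        L_X2_P_pderiv_Suc L_X2_P_Suc_pderiv L_X_P_P_Suc)
  moreover have "M (V * (one_minus_sq * ?f)) = 2 * \<alpha> * (\<beta> (Suc n) * h n)
      + 2 * t * M (one_minus_sq * ([:0, 1:] * ?f))"
    by (simp only: 1 M_add M_smult L_def[symmetric] L_X_P_P_Suc)
  ultimately show ?thesis by (simp add: r_def algebra_simps)
qed

text \<open>The value of \<open>M\<close> on \<open>f\<close> times the divided difference of \<open>v'\<close> at \<open>z\<close> and \<open>y\<close>, the latter cleared of
  the denominator \<open>(1 - z\<^sup>2)\<^sup>2 (1 - y\<^sup>2)\<^sup>2\<close>.\<close>

definition kernel_moment :: "'a::real_normed_field \<Rightarrow> real poly \<Rightarrow> 'a" where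
  "kernel_moment z f =
     of_real (2 * \<alpha>) * (1 - z\<^sup>2)
       * (of_real (M (one_minus_sq * f)) + z * of_real (M (one_minus_sq * ([:0, 1:] * f))))
     + of_real (2 * t) * (of_real (M f) + (2 * z - z ^ 3) * of_real (M ([:0, 1:] * f))
       - z\<^sup>2 * of_real (M ([:0, 1:]\<^sup>2 * f)) - z * of_real (M ([:0, 1:] ^ 3 * f)))"

lemma M_split: "M f = M (one_minus_sq * f) + M ([:0, 1:]\<^sup>2 * f)"
proof -
  have "one_minus_sq * f + [:0, 1:]\<^sup>2 * f = f"
    by (rule poly_ext) (simp add: power2_eq_square algebra_simps)
  then show ?thesis by (metis M_add)
qed

text \<open>P_n^2 is even, so moments with an odd power of y vanish; the others combine into
  \<open>moment_a\<close> and \<open>moment_R\<close>.\<close>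

lemma kernel_moment_P_P:
  "kernel_moment z ((P n)\<^sup>2) = of_real (h n) * (of_real (a n) * (1 - z\<^sup>2) + of_real (R n))"
proof -
  have sq: "(poly (P n) (- x))\<^sup>2 = (poly (P n) x)\<^sup>2" for x
    by (simp add: poly_P_reflect power_mult_distrib flip: power_mult)
  have odd: "M (one_minus_sq * ([:0, 1:] * (P n)\<^sup>2)) = 0" "M ([:0, 1:] * (P n)\<^sup>2) = 0"
    "M ([:0, 1:] ^ 3 * (P n)\<^sup>2) = 0"
    by (rule M_odd, simp only: poly_eval sq power2_minus power3_eq_cube mult_minus_left mult_minus_right minus_minus)+
  define m0 m1 where "m0 = M (one_minus_sq * (P n)\<^sup>2)" and "m1 = M ([:0, 1:]\<^sup>2 * (P n)\<^sup>2)"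
  have "kernel_moment z ((P n)\<^sup>2) =
      (1 - z\<^sup>2) * of_real (2 * \<alpha> * m0 + 2 * t * m1) + of_real (2 * t * m0)"
    unfolding kernel_moment_def odd M_split[of "(P n)\<^sup>2"] m0_def[symmetric] m1_def[symmetric]
    by (simp add: algebra_simps)
  then show ?thesis
    unfolding m0_def m1_def moment_a moment_R by (simp add: algebra_simps)
qed

text \<open>P_(n+1) P_n is odd, so moments with an even power of y vanish, and y^3 = y - (1 - y^2) y
  reduces the others to two.\<close>

lemma kernel_moment_P_P_Suc:
  "kernel_moment z (P (Suc n) * P n)
   = of_real (h n) * z * (of_nat (Suc n) * (1 - z\<^sup>2) + of_real (r (Suc n)))"
proof -
  let ?f = "P (Suc n) * P n"
  have prod: "poly (P (Suc n)) (- x) * poly (P n) (- x) = - (poly (P (Suc n)) x * poly (P n) x)" for x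
    by (simp add: poly_P_reflect flip: power_add mult_2)
  have even: "M (one_minus_sq * ?f) = 0" "M ?f = 0" "M ([:0, 1:]\<^sup>2 * ?f) = 0"
    by (rule M_odd, simp only: poly_eval prod power2_minus mult_minus_left mult_minus_right minus_minus)+
  define m0 m1 where "m0 = M (one_minus_sq * ([:0, 1:] * ?f))" and "m1 = M ([:0, 1:] * ?f)"
  have "[:0, 1:] * ?f - one_minus_sq * ([:0, 1:] * ?f) = [:0, 1:] ^ 3 * ?f"
    by (rule poly_ext) (simp add: eval_nat_numeral algebra_simps)
  then have m3: "M ([:0, 1:] ^ 3 * ?f) = m1 - m0"
    unfolding m0_def m1_def by (metis M_diff)
  have "kernel_moment z ?f =
      z * ((1 - z\<^sup>2) * of_real (2 * \<alpha> * m0 + 2 * t * m1) + of_real (2 * t * m0))"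
    unfolding kernel_moment_def even m3 m0_def[symmetric] m1_def[symmetric]
    by (simp add: algebra_simps eval_nat_numeral)
  then show ?thesis
    unfolding m0_def m1_def moment_n moment_r by (simp add: algebra_simps)
qed

text \<open>The cleared divided difference of v' at a real x, as a polynomial in y.\<close>

definition kernel :: "real \<Rightarrow> real poly" where
  "kernel x = smult (2 * \<alpha> * (1 - x\<^sup>2)) (one_minus_sq * [:1, x:])
     + smult (2 * t) [:1, 2 * x - x ^ 3, - x\<^sup>2, - x:]"

lemma M_kernel: "M (kernel x * f) = kernel_moment x f"
proof -
  have "kernel x * f =
      smult (2 * \<alpha> * (1 - x\<^sup>2)) (one_minus_sq * f)
      + smult (2 * \<alpha> * (1 - x\<^sup>2) * x) (one_minus_sq * ([:0, 1:] * f))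
      + smult (2 * t) f + smult (2 * t * (2 * x - x ^ 3)) ([:0, 1:] * f)
      - smult (2 * t * x\<^sup>2) ([:0, 1:]\<^sup>2 * f) - smult (2 * t * x) ([:0, 1:] ^ 3 * f)"
    by (rule poly_ext) (simp add: kernel_def, algebra)
  then have "M (kernel x * f) =
      2 * \<alpha> * (1 - x\<^sup>2) * M (one_minus_sq * f)
      + 2 * \<alpha> * (1 - x\<^sup>2) * x * M (one_minus_sq * ([:0, 1:] * f))
      + 2 * t * M f + 2 * t * (2 * x - x ^ 3) * M ([:0, 1:] * f)
      - 2 * t * x\<^sup>2 * M ([:0, 1:]\<^sup>2 * f) - 2 * t * x * M ([:0, 1:] ^ 3 * f)"
    by (simp only: M_add M_diff M_smult)
  then show ?thesis by (simp add: kernel_moment_def algebra_simps)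
qed

subsection \<open>Ladder relations and compatibility conditions\<close>

text \<open>In the induction step the recurrence rewrites the new term; its \<beta> contributions
  cancel the induction hypothesis because \<open>h (Suc n) = \<beta> (Suc n) * h n\<close>.\<close>

lemma christoffel_darboux:
  "(x - y) * (\<Sum>k<Suc n. poly (P k) x * poly (P k) y / h k)
   = (poly (P (Suc n)) x * poly (P n) y - poly (P n) x * poly (P (Suc n)) y) / h n"
proof (induction n)
  case 0
  show ?case using poly_recurrence[of x 0] poly_recurrence[of y 0] by (simp add: P_0 diff_divide_distrib)
next
  case (Suc n)
  let ?S = "\<Sum>k<Suc n. poly (P k) x * poly (P k) y / h k"
  have b: "\<beta> (Suc n) \<noteq> 0"
    using h_nonzero[of "Suc n"] by (simp add: h_Suc)
  have "(x - y) * (\<Sum>k<Suc (Suc n). poly (P k) x * poly (P k) y / h k)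
      = (x - y) * ?S + (x - y) * (poly (P (Suc n)) x * poly (P (Suc n)) y / h (Suc n))"
    by (simp add: distrib_left)
  also have "(x - y) * (poly (P (Suc n)) x * poly (P (Suc n)) y / h (Suc n))
      = ((x * poly (P (Suc n)) x) * poly (P (Suc n)) y
          - (y * poly (P (Suc n)) y) * poly (P (Suc n)) x) / h (Suc n)"
    by (simp add: algebra_simps diff_divide_distrib)
  also have "(x - y) * ?S + \<dots> = (poly (P (Suc (Suc n))) x * poly (P (Suc n)) y
      - poly (P (Suc n)) x * poly (P (Suc (Suc n))) y) / h (Suc n)"
    unfolding Suc.IH poly_recurrence h_Suc using b h_nonzero[of n] by (simp add: field_simps)
  finally show ?case .
qed

text \<open>\<open>A n\<close> and \<open>B n\<close> are \<open>(1 - z\<^sup>2)\<^sup>2 A\<^sub>n(z)\<close> and \<open>(1 - z\<^sup>2)\<^sup>2 B\<^sub>n(z)\<close>.\<close>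

definition A :: "nat \<Rightarrow> real poly" where
  "A n = [:a n + R n, 0, - a n:]"

definition B :: "nat \<Rightarrow> real poly" where
  "B n = [:0, real n + r n, 0, - real n:]"

text \<open>The Fourier sum of P_(n+1)' is an integral against the Christoffel-Darboux kernel
  \<open>K\<close>. Orthogonality permits replacing v'(y) by v'(y) - v'(x), whose factor x - y
  collapses \<open>K\<close> to two terms.\<close>

lemma ladder_at:
  "(1 - x\<^sup>2)\<^sup>2 * poly (pderiv (P (Suc n))) x =
   \<beta> (Suc n) * poly (A (Suc n)) x * poly (P n) x - poly (B (Suc n)) x * poly (P (Suc n)) x"
proof -
  define K where "K = (\<Sum>k<Suc n. smult (poly (P k) x / h k) (P k))"
  have K_y: "poly K y = (\<Sum>k<Suc n. poly (P k) x * poly (P k) y / h k)" for y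
    unfolding K_def poly_sum by (intro sum.cong) auto
  have low: "coeff (pderiv (P (Suc n))) i = 0" if "i \<ge> Suc n" for i
    using that by (simp add: coeff_pderiv)
  have lowK: "coeff K i = 0" if "i \<ge> Suc n" for i
    unfolding K_def coeff_sum using that by (intro sum.neutral) auto
  \<comment> \<open>P_k' has too low a degree to contribute, so the derivative of the whole product
    can be integrated by parts.\<close>
  have parts: "L (pderiv (P (Suc n)) * P k) = M (V * (P (Suc n) * P k))" if "k < Suc n" for k
  proof -
    have "L (P (Suc n) * pderiv (P k)) = 0"
      by (rule L_P_mult_low) (use that in \<open>simp add: coeff_pderiv\<close>)
    moreover have "L (pderiv (P (Suc n) * P k)) =
        L (P (Suc n) * pderiv (P k)) + L (pderiv (P (Suc n)) * P k)"
      by (simp only: pderiv_mult L_add mult.commute)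
    ultimately show ?thesis by (simp add: L_by_parts)
  qed
  have "poly (pderiv (P (Suc n))) x =
      (\<Sum>k<Suc n. L (pderiv (P (Suc n)) * P k) / h k * poly (P k) x)"
    by (subst fourier_expansion[OF low]) (simp_all add: poly_sum del: sum.lessThan_Suc)
  also have "\<dots> = (\<Sum>k<Suc n. poly (P k) x / h k * M (V * (P (Suc n) * P k)))"
    by (intro sum.cong) (simp_all add: parts)
  also have "\<dots> = M (\<Sum>k<Suc n. smult (poly (P k) x / h k) (V * (P (Suc n) * P k)))"
    by (simp only: M_sum M_smult)
  also have "(\<Sum>k<Suc n. smult (poly (P k) x / h k) (V * (P (Suc n) * P k))) = V * (P (Suc n) * K)"
    unfolding K_def sum_distrib_left by (simp only: mult_smult_right)
  finally have deriv: "poly (pderiv (P (Suc n))) x = M (V * (P (Suc n) * K))" .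
  have "L (P (Suc n) * K) = 0"
    by (rule L_P_mult_low) (rule lowK)
  then have orth: "M (one_minus_sq\<^sup>2 * (P (Suc n) * K)) = 0"
    by (simp only: L_def)
  have eq: "smult ((1 - x\<^sup>2)\<^sup>2) (V * (P (Suc n) * K))
      - smult (poly V x) (one_minus_sq\<^sup>2 * (P (Suc n) * K)) =
      smult (poly (P n) x / h n) (kernel x * (P (Suc n))\<^sup>2)
      - smult (poly (P (Suc n)) x / h n) (kernel x * (P (Suc n) * P n))"
  proof (rule poly_ext)
    fix y
    \<comment> \<open>The cleared divided difference of v' multiplied back by y - x.\<close>
    have "(1 - x\<^sup>2)\<^sup>2 * poly V y - poly V x * (1 - y\<^sup>2)\<^sup>2 = - poly (kernel x) y * (x - y)"
      unfolding V_def kernel_def by simp algebra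
    then have "((1 - x\<^sup>2)\<^sup>2 * poly V y - poly V x * (1 - y\<^sup>2)\<^sup>2) * (poly (P (Suc n)) y * poly K y) =
        - poly (kernel x) y * poly (P (Suc n)) y * ((x - y) * poly K y)"
      by simp
    also have "(x - y) * poly K y =
        (poly (P (Suc n)) x * poly (P n) y - poly (P n) x * poly (P (Suc n)) y) / h n"
      unfolding K_y by (rule christoffel_darboux)
    finally show "poly (smult ((1 - x\<^sup>2)\<^sup>2) (V * (P (Suc n) * K))
      - smult (poly V x) (one_minus_sq\<^sup>2 * (P (Suc n) * K))) y =
      poly (smult (poly (P n) x / h n) (kernel x * (P (Suc n))\<^sup>2)
      - smult (poly (P (Suc n)) x / h n) (kernel x * (P (Suc n) * P n))) y"
      using h_nonzero[of n] by (simp add: field_simps power2_eq_square)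
  qed
  have "(1 - x\<^sup>2)\<^sup>2 * poly (pderiv (P (Suc n))) x =
      poly (P n) x / h n * kernel_moment x ((P (Suc n))\<^sup>2)
      - poly (P (Suc n)) x / h n * kernel_moment x (P (Suc n) * P n)"
    using arg_cong[OF eq, of M] by (simp add: M_diff M_smult deriv orth M_kernel)
  also have "\<dots> = \<beta> (Suc n) * (a (Suc n) * (1 - x\<^sup>2) + R (Suc n)) * poly (P n) x
      - x * (real (Suc n) * (1 - x\<^sup>2) + r (Suc n)) * poly (P (Suc n)) x"
    unfolding kernel_moment_P_P kernel_moment_P_P_Suc h_Suc using h_nonzero[of n] by simp
  finally show ?thesis
    by (simp add: A_def B_def algebra_simps power2_eq_square)
qed

lemma ladder: "one_minus_sq\<^sup>2 * pderiv (P n) = smult (\<beta> n) (A n * P (n - 1)) - B n * P n"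
proof (cases n)
  case 0
  then show ?thesis by (simp add: P_0 B_def r_def subcoeff_def)
next
  case (Suc m)
  show ?thesis unfolding Suc
    by (rule poly_ext) (use ladder_at[of _ m] in \<open>simp add: power2_eq_square algebra_simps\<close>)
qed

lemma compatibility_1: "B (Suc n) + B n = [:0, 1:] * A n - V"
  by (simp add: A_def B_def V_def a_def R_def r_def subcoeff_Suc algebra_simps)

text \<open>For n = m + 1 this is the lowering relation for P_m, with P_(m-1) eliminated by the
  recurrence and \<open>B m\<close> by \<open>compatibility_1\<close>. The factor
  \<open>\<beta> n\<close> covers n = 0, where n - 1 truncates.\<close>

lemma ladder_raising:
  "smult (\<beta> n) (one_minus_sq\<^sup>2 * pderiv (P (n - 1)))
   = smult (\<beta> n) ((B n + V) * P (n - 1) - A (n - 1) * P n)"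
proof (cases n)
  case (Suc m)
  have "poly (one_minus_sq\<^sup>2 * pderiv (P m)) x = poly ((B n + V) * P m - A m * P n) x" for x
  proof -
    have 1: "(1 - x\<^sup>2)\<^sup>2 * poly (pderiv (P m)) x
        = poly (A m) x * (\<beta> m * poly (P (m - 1)) x) - poly (B m) x * poly (P m) x"
      using arg_cong[OF ladder[of m], of "\<lambda>p. poly p x"] by (simp only: poly_eval mult.left_commute)
    have 2: "\<beta> m * poly (P (m - 1)) x = x * poly (P m) x - poly (P n) x"
      using poly_recurrence[of x m] by (simp add: Suc)
    have 3: "poly (B m) x = x * poly (A m) x - poly V x - poly (B n) x"
      using arg_cong[OF compatibility_1[of m], of "\<lambda>p. poly p x"] by (simp add: Suc)
    show ?thesis
      by (simp only: poly_eval 1 2 3) (simp add: algebra_simps)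
  qed
  then show ?thesis using poly_ext Suc by (metis diff_Suc_1)
qed simp

lemma compatibility_2:
  "one_minus_sq\<^sup>2 + [:0, 1:] * (B (Suc n) - B n) = smult (\<beta> (Suc n)) (A (Suc n)) - smult (\<beta> n) (A (n - 1))"
proof -
  \<comment> \<open>The identity is proved times P_n, a nonzero polynomial that can be
    cancelled.\<close>
  have "P n * (one_minus_sq\<^sup>2 + [:0, 1:] * (B (Suc n) - B n)
      - (smult (\<beta> (Suc n)) (A (Suc n)) - smult (\<beta> n) (A (n - 1)))) = 0"
  proof (rule poly_ext)
    fix x
    define p p1 p0 where "p = poly (P n) x" and "p1 = poly (P (Suc n)) x" and "p0 = \<beta> n * poly (P (n - 1)) x"
    define q where "q = (1 - x\<^sup>2)\<^sup>2"
    define A1 A' A0 B1 B' where "A1 = \<beta> (Suc n) * poly (A (Suc n)) x" and "A' = poly (A n) x"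
      and "A0 = \<beta> n * poly (A (n - 1)) x" and "B1 = poly (B (Suc n)) x" and "B' = poly (B n) x"
    note defs = p_def p1_def p0_def q_def A1_def A'_def A0_def B1_def B'_def
    have "p + x * poly (pderiv (P n)) x =
        poly (pderiv (P (Suc n))) x + \<beta> n * poly (pderiv (P (n - 1))) x"
      using arg_cong[OF recurrence[of n], of "\<lambda>p. poly (pderiv p) x"]
      by (simp add: pderiv_pCons pderiv_add pderiv_smult p_def)
    from arg_cong[OF this, of "\<lambda>y. q * y"]
    have "q * p + x * (q * poly (pderiv (P n)) x) =
        q * poly (pderiv (P (Suc n))) x + \<beta> n * (q * poly (pderiv (P (n - 1))) x)"
      by (simp add: algebra_simps)
    also have "q * poly (pderiv (P (Suc n))) x = A1 * p - B1 * p1"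
      using arg_cong[OF ladder[of "Suc n"], of "\<lambda>p. poly p x"]
      by (simp only: poly_eval defs diff_Suc_1 mult.assoc)
    also have "\<beta> n * (q * poly (pderiv (P (n - 1))) x) = (B' + poly V x) * p0 - A0 * p"
      using arg_cong[OF ladder_raising[of n], of "\<lambda>p. poly p x"]
      by (simp only: poly_eval defs) (simp add: algebra_simps)
    also have "q * poly (pderiv (P n)) x = A' * p0 - B' * p"
      using arg_cong[OF ladder[of n], of "\<lambda>p. poly p x"]
      by (simp only: poly_eval defs) (simp add: algebra_simps)
    also have "p1 = x * p - p0"
      using poly_recurrence[of x n] by (simp add: defs)
    also have "poly V x = x * A' - B1 - B'"
      using arg_cong[OF compatibility_1[of n], of "\<lambda>p. poly p x"] by (simp add: defs)
    \<comment> \<open>\<open>p0\<close> has the coefficient \<open>x * A'\<close> on both sides, so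
      only multiples of \<open>p\<close> remain.\<close>
    finally have "p * (q + x * (B1 - B') - (A1 - A0)) = 0"
      by (simp add: algebra_simps)
    then show "poly (P n * (one_minus_sq\<^sup>2 + [:0, 1:] * (B (Suc n) - B n)
      - (smult (\<beta> (Suc n)) (A (Suc n)) - smult (\<beta> n) (A (n - 1))))) x = poly 0 x"
      by (simp only: poly_eval defs)
  qed
  then show ?thesis using P_nonzero[of n] by simp
qed

text \<open>The sum carries an extra \<open>one_minus_sq\<^sup>2\<close> because the other terms are
  products of two cleared functions. In the step, \<open>compatibility_1\<close> turns x A_n
  (B_(n+1) - B_n) into the increment of B_n^2 plus v' times that of B_n.\<close>

lemma compatibility_2':
  "(B n)\<^sup>2 + V * B n + one_minus_sq\<^sup>2 * (\<Sum>j<n. A j) = smult (\<beta> n) (A n * A (n - 1))"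
proof (induction n)
  case 0
  show ?case by (simp add: B_def r_def subcoeff_def)
next
  case (Suc n)
  show ?case
  proof (rule poly_ext)
    fix x
    show "poly ((B (Suc n))\<^sup>2 + V * B (Suc n) + one_minus_sq\<^sup>2 * (\<Sum>j<Suc n. A j)) x =
        poly (smult (\<beta> (Suc n)) (A (Suc n) * A (Suc n - 1))) x"
    proof -
      define S q where "S = poly (\<Sum>j<n. A j) x" and "q = (1 - x\<^sup>2)\<^sup>2"
      have 1: "q * S = \<beta> n * (poly (A n) x * poly (A (n - 1)) x)
          - (poly (B n) x)\<^sup>2 - poly V x * poly (B n) x"
        using arg_cong[OF Suc.IH, of "\<lambda>p. poly p x"]
        by (simp only: poly_eval S_def q_def diff_eq_eq eq_diff_eq ac_simps)
      have 2: "poly V x = x * poly (A n) x - poly (B (Suc n)) x - poly (B n) x"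
        using arg_cong[OF compatibility_1[of n], of "\<lambda>p. poly p x"] by simp
      have 3: "q = \<beta> (Suc n) * poly (A (Suc n)) x - \<beta> n * poly (A (n - 1)) x
          - x * (poly (B (Suc n)) x - poly (B n) x)"
        using arg_cong[OF compatibility_2[of n], of "\<lambda>p. poly p x"]
        by (simp only: poly_eval q_def eq_diff_eq)
      have "(poly (B (Suc n)) x)\<^sup>2 + poly V x * poly (B (Suc n)) x + (q * S + q * poly (A n) x)
          = \<beta> (Suc n) * (poly (A (Suc n)) x * poly (A n) x)"
        \<comment> \<open>\<open>3\<close> comes in a second pass, as it would otherwise rewrite the
          \<open>q\<close> inside \<open>q * S\<close> before \<open>1\<close> applies.\<close>
        unfolding 1 2 unfolding 3 by (simp add: algebra_simps power2_eq_square)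
      then show ?thesis
        by (simp only: poly_eval sum.lessThan_Suc diff_Suc_1 S_def q_def distrib_left)
    qed
  qed
qed

lemma sum_a: "(\<Sum>j<n. a j) = (real n)\<^sup>2 + 2 * real n * \<alpha>"
  by (induction n) (simp_all add: a_def power2_eq_square algebra_simps)

lemma sum_R: "(\<Sum>j<n. R j) = real n * (real n + 2 * t) - (2 * real n + 1 + 2 * \<alpha>) * \<beta> n
    + 4 * (real n + \<alpha>) * \<sigma> n"
  by (induction n) (simp_all add: R_def subcoeff_Suc subcoeff_def[of P 0] algebra_simps)

end
subsection \<open>The weight and the complex ladder functions\<close>

definition weight_over :: "real \<Rightarrow> real \<Rightarrow> real \<Rightarrow> real" where
  "weight_over \<alpha> t y = weight \<alpha> t y / (1 - y\<^sup>2)\<^sup>2"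

lemma weight_eq_weight_over: "weight \<alpha> t y = (1 - y\<^sup>2)\<^sup>2 * weight_over \<alpha> t y"
  by (cases "1 - y\<^sup>2 = 0") (simp_all add: weight_over_def weight_def)

lemma continuous_on_weight_over:
  assumes "\<alpha> > 0" "t > 0"
  shows "continuous_on {-1..1} (weight_over \<alpha> t)"
proof -
  \<comment> \<open>In u = 1 - y^2 only a one-sided limit at 0 is at stake: the exponential beats
    the power of u, and the conventional value \<open>g 0 = 0\<close> is the limit.\<close>
  define g where "g u = u powr \<alpha> * exp (- t / u) / u\<^sup>2" for u :: real
  have lim: "(g \<longlongrightarrow> 0) (at_right 0)"
    unfolding g_def using assms by real_asymp
  have "continuous_on {0..} g"
    unfolding continuous_on_def
  proof
    fix u :: real assume "u \<in> {0..}"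
    show "(g \<longlongrightarrow> g u) (at u within {0..})"
    proof (cases "u = 0")
      case True
      have "at 0 within {0::real..} = at_right 0"
        unfolding at_within_def by (intro arg_cong2[of _ _ _ _ inf] arg_cong[of _ _ principal]) auto
      with lim True show ?thesis by (simp add: g_def)
    next
      case False
      with \<open>u \<in> {0..}\<close> have "isCont g u"
        unfolding g_def by (auto intro!: continuous_intros)
      then show ?thesis
        unfolding isCont_def by (rule tendsto_within_subset) simp
    qed
  qed
  then have "continuous_on {-1..1} (\<lambda>y. g (1 - y\<^sup>2))"
    by (rule continuous_on_compose2) (auto intro!: continuous_intros simp: abs_square_le_1 abs_le_iff)
  then show ?thesis
    by (simp add: g_def weight_over_def weight_def)
qed

text \<open>This is w' = - v' w with the denominator (1 - x^2)^2 absorbed into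
  \<open>weight_over\<close>.\<close>

lemma weight_has_real_derivative:
  assumes "x \<in> {-1<..<1}"
  shows "(weight \<alpha> t has_real_derivative - (2 * \<alpha> * x * (1 - x\<^sup>2) + 2 * t * x) * weight_over \<alpha> t x) (at x)"
proof -
  have pos: "1 - x\<^sup>2 > 0" using assms by (simp add: abs_square_less_1 abs_less_iff)
  define u where "u = 1 - x\<^sup>2"
  have u: "u > 0" using pos by (simp add: u_def)
  have "(weight \<alpha> t has_real_derivative
      \<alpha> * u powr (\<alpha> - 1) * (- 2 * x) * exp (- t / u) + u powr \<alpha> * (exp (- t / u) * (- t * (2 * x) / u\<^sup>2)))
      (at x)"
    unfolding weight_def [abs_def] u_def using pos
    by (auto intro!: derivative_eq_intros simp: power2_eq_square)
  also have "\<alpha> * u powr (\<alpha> - 1) * (- 2 * x) * exp (- t / u)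
      + u powr \<alpha> * (exp (- t / u) * (- t * (2 * x) / u\<^sup>2))
    = - (2 * \<alpha> * x * u + 2 * t * x) * (u powr \<alpha> * exp (- t / u) / u\<^sup>2)"
    using u by (simp add: powr_diff field_simps power2_eq_square)
  finally show ?thesis
    unfolding u_def weight_over_def weight_def .
qed

section \<open>Real polynomials at complex points\<close>

lemma cpoly_0 [simp]: "cpoly 0 z = 0"
  and cpoly_pCons [simp]: "cpoly (pCons c p) z = of_real c + z * cpoly p z"
  by (simp_all add: cpoly_def map_poly_pCons)

lemma cpoly_smult [simp]: "cpoly (smult c p) z = of_real c * cpoly p z"
  by (induction p) (simp_all add: algebra_simps)

lemma cpoly_add [simp]: "cpoly (p + q) z = cpoly p z + cpoly q z"
proof (induction p arbitrary: q)
  case (pCons c p)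
  then show ?case by (cases q) (simp add: algebra_simps)
qed simp

lemma cpoly_diff [simp]: "cpoly (p - q) z = cpoly p z - cpoly q z"
  using cpoly_add[of "p - q" q z] by simp

lemma cpoly_mult [simp]: "cpoly (p * q) z = cpoly p z * cpoly q z"
  by (induction p) (simp_all add: algebra_simps)

lemma cpoly_sum [simp]: "cpoly (\<Sum>i\<in>I. f i) z = (\<Sum>i\<in>I. cpoly (f i) z)"
  by (induction I rule: infinite_finite_induct) simp_all

lemma cpoly_has_field_derivative: "(cpoly p has_field_derivative cpoly (pderiv p) z) (at z)"
proof (induction p)
  case 0
  have "cpoly 0 = (\<lambda>_. 0)" by auto
  then show ?case by simp
next
  case (pCons c p)
  have "cpoly (pCons c p) = (\<lambda>z. of_real c + z * cpoly p z)" by auto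
  then show ?case
    by (auto intro!: derivative_eq_intros pCons.IH simp: pderiv_pCons)
qed

lemma deriv_cpoly: "deriv (cpoly p) = cpoly (pderiv p)"
  using DERIV_imp_deriv[OF cpoly_has_field_derivative] by auto

section \<open>The derivative of the potential and its divided difference\<close>

lemma v_deriv_eq:
  assumes "z\<^sup>2 \<noteq> 1"
  shows "v_deriv \<alpha> t z = (of_real (2 * \<alpha>) * z * (1 - z\<^sup>2) + of_real (2 * t) * z) / (1 - z\<^sup>2)\<^sup>2"
proof -
  have nz: "1 - z\<^sup>2 \<noteq> 0" using assms by simp
  \<comment> \<open>At the base point the second logarithm has argument 1, off the branch cut, and
    the first one is constant.\<close>
  have "(v_branch \<alpha> t z has_field_derivative
      of_real t * (2 * z) / (1 - z\<^sup>2)\<^sup>2 + of_real \<alpha> * (2 * z / (1 - z\<^sup>2))) (at z)"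
    unfolding v_branch_def [abs_def] using nz
    by (auto intro!: derivative_eq_intros simp: power2_eq_square)
  then have "v_deriv \<alpha> t z = of_real t * (2 * z) / (1 - z\<^sup>2)\<^sup>2 + of_real \<alpha> * (2 * z / (1 - z\<^sup>2))"
    unfolding v_deriv_def by (rule DERIV_imp_deriv)
  moreover have "of_real (2 * \<alpha>) * z * (1 - z\<^sup>2) / (1 - z\<^sup>2)\<^sup>2 = of_real \<alpha> * (2 * z / (1 - z\<^sup>2))"
    using nz by (simp add: power2_eq_square)
  ultimately show ?thesis by (simp add: add_divide_distrib)
qed

text \<open>Here \<open>w\<close> is a second point, not the weight. Cross-multiplying leaves a
  polynomial identity.\<close>

lemma divided_difference_v_deriv:
  assumes "z\<^sup>2 \<noteq> 1" "w\<^sup>2 \<noteq> 1" "z \<noteq> w"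
  shows "(v_deriv \<alpha> t z - v_deriv \<alpha> t w) / (z - w) =
    (of_real (2 * \<alpha>) * (1 - z\<^sup>2) * (1 - w\<^sup>2) * (1 + z * w)
      + of_real (2 * t) * (1 + (2 * z - z ^ 3) * w - z\<^sup>2 * w\<^sup>2 - z * w ^ 3))
    / ((1 - z\<^sup>2)\<^sup>2 * (1 - w\<^sup>2)\<^sup>2)"
proof -
  have nz: "1 - z\<^sup>2 \<noteq> 0" "1 - w\<^sup>2 \<noteq> 0" "z - w \<noteq> 0" using assms by auto
  have "(of_real (2 * \<alpha>) * z * (1 - z\<^sup>2) + of_real (2 * t) * z) * (1 - w\<^sup>2)\<^sup>2
      - (of_real (2 * \<alpha>) * w * (1 - w\<^sup>2) + of_real (2 * t) * w) * (1 - z\<^sup>2)\<^sup>2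
    = (of_real (2 * \<alpha>) * (1 - z\<^sup>2) * (1 - w\<^sup>2) * (1 + z * w)
      + of_real (2 * t) * (1 + (2 * z - z ^ 3) * w - z\<^sup>2 * w\<^sup>2 - z * w ^ 3)) * (z - w)"
    by algebra
  then show ?thesis
    unfolding v_deriv_eq[OF assms(1)] v_deriv_eq[OF assms(2)] using nz
    by (simp add: diff_frac_eq frac_eq_eq eq_divide_eq)
qed

section \<open>The functional given by the weight\<close>

locale weight_polynomials =
  fixes \<alpha> t :: real and P :: "nat \<Rightarrow> real poly"
  assumes \<alpha>_pos: "\<alpha> > 0" and t_pos: "t > 0"
    and orthogonal: "monic_orthogonal (weight \<alpha> t) P"
begin

definition M :: "real poly \<Rightarrow> real" where
  "M p = integral {-1..1} (\<lambda>y. poly p y * weight_over \<alpha> t y)"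

lemma continuous_on_integrand: "continuous_on {-1..1} (\<lambda>y. poly p y * weight_over \<alpha> t y)"
  by (intro continuous_intros continuous_on_weight_over \<alpha>_pos t_pos)

lemma M_has_integral: "((\<lambda>y. poly p y * weight_over \<alpha> t y) has_integral M p) {-1..1}"
  unfolding M_def
  by (intro integrable_integral integrable_continuous_interval continuous_on_integrand)

lemma M_one_minus_sq: "M (one_minus_sq\<^sup>2 * p) = integral {-1..1} (\<lambda>y. poly p y * weight \<alpha> t y)"
  unfolding M_def weight_eq_weight_over
  by (intro arg_cong[of _ _ "integral {-1..1}"] ext) (simp add: power2_eq_square algebra_simps)

text \<open>The fundamental theorem of calculus for p w; the boundary terms vanish with the
  weight.\<close>

lemma M_integrate_by_parts:
  "M (one_minus_sq\<^sup>2 * pderiv p) = M ([:0, 2 * \<alpha> + 2 * t, 0, - 2 * \<alpha>:] * p)"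
proof -
  let ?V = "[:0, 2 * \<alpha> + 2 * t, 0, - 2 * \<alpha>:]"
  have "((\<lambda>y. poly (one_minus_sq\<^sup>2 * pderiv p - ?V * p) y * weight_over \<alpha> t y) has_integral
      (poly p 1 * weight \<alpha> t 1 - poly p (-1) * weight \<alpha> t (-1))) {-1..1}"
  proof (rule fundamental_theorem_of_calculus_interior)
    show "continuous_on {-1..1} (\<lambda>y. poly p y * weight \<alpha> t y)"
      unfolding weight_eq_weight_over
      by (intro continuous_intros continuous_on_weight_over \<alpha>_pos t_pos)
    show "((\<lambda>y. poly p y * weight \<alpha> t y) has_vector_derivative
        poly (one_minus_sq\<^sup>2 * pderiv p - ?V * p) x * weight_over \<alpha> t x) (at x)"
      if "x \<in> {-1<..<1}" for x
    proof -
      have "((\<lambda>y. poly p y * weight \<alpha> t y) has_real_derivative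
          poly (pderiv p) x * weight \<alpha> t x
          + (- (2 * \<alpha> * x * (1 - x\<^sup>2) + 2 * t * x) * weight_over \<alpha> t x) * poly p x) (at x)"
        by (rule DERIV_mult[OF poly_DERIV weight_has_real_derivative[OF that]])
      also have "poly (pderiv p) x * weight \<alpha> t x
          + (- (2 * \<alpha> * x * (1 - x\<^sup>2) + 2 * t * x) * weight_over \<alpha> t x) * poly p x
        = poly (one_minus_sq\<^sup>2 * pderiv p - ?V * p) x * weight_over \<alpha> t x"
        unfolding weight_eq_weight_over by (simp add: power2_eq_square algebra_simps)
      finally show ?thesis
        by (simp add: has_real_derivative_iff_has_vector_derivative)
    qed
  qed simp
  then have "M (one_minus_sq\<^sup>2 * pderiv p - ?V * p) = 0"
    unfolding M_def by (simp add: integral_unique weight_def)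
  moreover have "M (one_minus_sq\<^sup>2 * pderiv p - ?V * p) = M (one_minus_sq\<^sup>2 * pderiv p) - M (?V * p)"
    by (rule has_integral_unique[OF M_has_integral])
      (simp only: poly_diff left_diff_distrib has_integral_diff[OF M_has_integral M_has_integral])
  ultimately show ?thesis by simp
qed

text \<open>A zero integral of this continuous nonnegative function would give p infinitely many
  roots in (-1, 1).\<close>

lemma weight_integral_pos:
  assumes "p \<noteq> 0"
  shows "M (one_minus_sq\<^sup>2 * p\<^sup>2) > 0"
proof -
  let ?f = "\<lambda>y. poly (one_minus_sq\<^sup>2 * p\<^sup>2) y * weight_over \<alpha> t y"
  have nonneg: "?f y \<ge> 0" for y
    by (auto simp: weight_over_def weight_def)
  have "integral {-1..1} ?f \<noteq> 0"
  proof
    assume "integral {-1..1} ?f = 0"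
    then have zero: "?f y = 0" if "y \<in> {-1..1}" for y
      using integral_eq_0_iff[OF continuous_on_integrand _ nonneg] that by simp
    have "poly p y = 0" if "y \<in> {-1<..<1}" for y
    proof -
      have "1 - y\<^sup>2 > 0" using that by (simp add: abs_square_less_1 abs_less_iff)
      then have "weight_over \<alpha> t y > 0"
        by (simp add: weight_over_def weight_def)
      moreover have "(1 - y\<^sup>2)\<^sup>2 * (poly p y)\<^sup>2 * weight_over \<alpha> t y = 0"
        using zero[of y] that by (simp only: poly_eval greaterThanLessThan_iff atLeastAtMost_iff less_imp_le simp_thms)
      ultimately show ?thesis
        using \<open>1 - y\<^sup>2 > 0\<close> by (metis less_numeral_extra(3) mult_eq_0_iff power_eq_0_iff)
    qed
    then have "{-1<..<1} \<subseteq> {y. poly p y = 0}" by auto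
    then have "finite {-1<..<1::real}"
      by (rule finite_subset[OF _ poly_roots_finite[OF assms]])
    then show False
      using infinite_Ioo[of "-1::real" 1] by simp
  qed
  moreover have "integral {-1..1} ?f \<ge> 0"
    by (intro integral_nonneg integrable_continuous_interval continuous_on_integrand nonneg)
  ultimately show ?thesis by (simp add: M_def)
qed

sublocale even_weight_functional \<alpha> t M P
proof
  show "M (p + q) = M p + M q" for p q
    by (rule has_integral_unique[OF M_has_integral])
      (use has_integral_add[OF M_has_integral M_has_integral] in \<open>simp add: distrib_right\<close>)
  show "M (smult c p) = c * M p" for c p
    by (simp add: M_def mult.assoc)
  show "M (pcompose p [:0, -1:]) = M p" for p
  proof -
    have "M (pcompose p [:0, -1:]) = integral {- 1.. - (- 1)} (\<lambda>y. poly p (- y) * weight_over \<alpha> t (- y))"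
      by (simp add: M_def poly_pcompose weight_over_def weight_def)
    also have "\<dots> = M p"
      unfolding M_def by (rule Henstock_Kurzweil_Integration.integral_reflect_real)
    finally show ?thesis .
  qed
  have monic: "degree (P n) = n \<and> lead_coeff (P n) = 1" for n
    using orthogonal unfolding monic_orthogonal_def by (elim conjE) (erule spec)
  show "degree (P n) = n" for n
    by (rule monic[THEN conjunct1])
  show "lead_coeff (P n) = 1" for n
    by (rule monic[THEN conjunct2])
  show "M (one_minus_sq\<^sup>2 * (P m * P n)) = 0" if "m \<noteq> n" for m n
    using orthogonal that by (simp add: M_one_minus_sq monic_orthogonal_def)
qed (fact M_integrate_by_parts weight_integral_pos)+

lemma sqnorm_eq: "sqnorm (weight \<alpha> t) P n = h n"
  by (simp add: sqnorm_def h_def L_def M_one_minus_sq)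

lemma beta_eq: "beta (weight \<alpha> t) P n = \<beta> n"
  by (simp add: beta_def \<beta>_def sqnorm_eq)

section \<open>Closed forms of A_n and B_n\<close>

lemma kernel_integral:
  assumes "z\<^sup>2 \<noteq> 1"
  shows "integral {-1..1} (\<lambda>y. (v_deriv \<alpha> t z - v_deriv \<alpha> t (of_real y)) / (z - of_real y)
      * of_real (poly f y * weight \<alpha> t y)) = kernel_moment z f / (1 - z\<^sup>2)\<^sup>2"
proof -
  define I :: "real poly \<Rightarrow> real \<Rightarrow> complex"
    where "I q y = of_real (poly q y * weight_over \<alpha> t y)" for q y
  have I: "(I q has_integral of_real (M q)) {-1..1}" for q
    unfolding I_def by (intro has_integral_of_real M_has_integral)
  let ?g = "\<lambda>y. (of_real (2 * \<alpha>) * (1 - z\<^sup>2)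
        * (I (one_minus_sq * f) y + z * I (one_minus_sq * ([:0, 1:] * f)) y)
     + of_real (2 * t) * (I f y + (2 * z - z ^ 3) * I ([:0, 1:] * f) y
       - z\<^sup>2 * I ([:0, 1:]\<^sup>2 * f) y - z * I ([:0, 1:] ^ 3 * f) y)) * (1 / (1 - z\<^sup>2)\<^sup>2)"
  have "(?g has_integral kernel_moment z f * (1 / (1 - z\<^sup>2)\<^sup>2)) {-1..1}"
    unfolding kernel_moment_def
    by (intro has_integral_add has_integral_diff has_integral_mult_right has_integral_mult_left I)
  then have "((\<lambda>y. (v_deriv \<alpha> t z - v_deriv \<alpha> t (of_real y)) / (z - of_real y)
      * of_real (poly f y * weight \<alpha> t y)) has_integral kernel_moment z f * (1 / (1 - z\<^sup>2)\<^sup>2)) {-1..1}"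
  proof (rule has_integral_spike_finite[rotated 2])
    \<comment> \<open>The exempted points are the endpoints, where v' is singular, and the possible
      zero of z - y.\<close>
    show "finite {1, -1, Re z}" by simp
    fix y assume y: "y \<in> {-1..1} - {1, -1, Re z}"
    then have "y\<^sup>2 \<noteq> 1" by (auto simp: power2_eq_1_iff)
    then have y2: "(complex_of_real y)\<^sup>2 \<noteq> 1"
      by (metis of_real_1 of_real_eq_iff of_real_power)
    have "z \<noteq> of_real y" using y by auto
    note dd = divided_difference_v_deriv[OF assms y2 this]
    have nz: "1 - z\<^sup>2 \<noteq> 0" "1 - (complex_of_real y)\<^sup>2 \<noteq> 0" using assms y2 by auto
    show "(v_deriv \<alpha> t z - v_deriv \<alpha> t (of_real y)) / (z - of_real y)
      * of_real (poly f y * weight \<alpha> t y) = ?g y"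
    proof -
      define N F W where "N = of_real (2 * \<alpha>) * (1 - z\<^sup>2) * (1 - (of_real y)\<^sup>2) * (1 + z * of_real y)
          + of_real (2 * t) * (1 + (2 * z - z ^ 3) * of_real y - z\<^sup>2 * (of_real y)\<^sup>2 - z * of_real y ^ 3)"
        and "F = complex_of_real (poly f y)" and "W = complex_of_real (weight_over \<alpha> t y)"
      have "of_real (poly f y * weight \<alpha> t y) = F * (1 - (of_real y)\<^sup>2)\<^sup>2 * W"
        by (simp add: weight_eq_weight_over F_def W_def)
      then have "(v_deriv \<alpha> t z - v_deriv \<alpha> t (of_real y)) / (z - of_real y)
          * of_real (poly f y * weight \<alpha> t y) = N * F * W * (1 / (1 - z\<^sup>2)\<^sup>2)"
        unfolding dd N_def[symmetric] using nz by simp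
      also have "N * F * W = of_real (2 * \<alpha>) * (1 - z\<^sup>2)
        * (I (one_minus_sq * f) y + z * I (one_minus_sq * ([:0, 1:] * f)) y)
     + of_real (2 * t) * (I f y + (2 * z - z ^ 3) * I ([:0, 1:] * f) y
       - z\<^sup>2 * I ([:0, 1:]\<^sup>2 * f) y - z * I ([:0, 1:] ^ 3 * f) y)"
        unfolding I_def poly_eval N_def F_def W_def by (simp add: algebra_simps)
      finally show ?thesis .
    qed
  qed
  then show ?thesis by (simp add: integral_unique)
qed

lemma ladder_A_eq:
  assumes "z\<^sup>2 \<noteq> 1"
  shows "ladder_A \<alpha> t P n z = of_real (a n) / (1 - z\<^sup>2) + of_real (R n) / (1 - z\<^sup>2)\<^sup>2"
proof -
  have "ladder_A \<alpha> t P n z = 1 / of_real (h n) * (kernel_moment z ((P n)\<^sup>2) / (1 - z\<^sup>2)\<^sup>2)"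
    unfolding ladder_A_def sqnorm_eq poly_power[symmetric] kernel_integral[OF assms] ..
  also have "\<dots> = (of_real (a n) * (1 - z\<^sup>2) + of_real (R n)) / (1 - z\<^sup>2)\<^sup>2"
    unfolding kernel_moment_P_P using h_nonzero[of n] by simp
  finally show ?thesis
    using assms by (simp add: add_divide_distrib power2_eq_square[of "1 - z\<^sup>2"])
qed

lemma ladder_B_eq:
  assumes "z\<^sup>2 \<noteq> 1"
  shows "ladder_B \<alpha> t P n z = of_nat n * z / (1 - z\<^sup>2) + z * of_real (r n) / (1 - z\<^sup>2)\<^sup>2"
proof (cases n)
  case 0
  then show ?thesis by (simp add: ladder_B_def r_def subcoeff_def)
next
  case (Suc m)
  have "ladder_B \<alpha> t P n z = 1 / of_real (h m) * (kernel_moment z (P (Suc m) * P m) / (1 - z\<^sup>2)\<^sup>2)"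
    unfolding ladder_B_def sqnorm_eq poly_mult[symmetric] kernel_integral[OF assms] by (simp add: Suc)
  also have "\<dots> = z * (of_nat n * (1 - z\<^sup>2) + of_real (r n)) / (1 - z\<^sup>2)\<^sup>2"
    unfolding kernel_moment_P_P_Suc Suc using h_nonzero[of m] by simp
  finally show ?thesis
    using assms by (simp add: distrib_left add_divide_distrib power2_eq_square[of "1 - z\<^sup>2"])
qed

section \<open>The ladder identities at complex points\<close>

lemma cpoly_A: "z\<^sup>2 \<noteq> 1 \<Longrightarrow> cpoly (A n) z = (1 - z\<^sup>2)\<^sup>2 * ladder_A \<alpha> t P n z"
  by (simp add: ladder_A_eq A_def distrib_left power2_eq_square[of "1 - z\<^sup>2"])
    (simp add: power2_eq_square algebra_simps)

lemma cpoly_B: "z\<^sup>2 \<noteq> 1 \<Longrightarrow> cpoly (B n) z = (1 - z\<^sup>2)\<^sup>2 * ladder_B \<alpha> t P n z"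
  by (simp add: ladder_B_eq B_def distrib_left power2_eq_square[of "1 - z\<^sup>2"])
    (simp add: power2_eq_square algebra_simps)

lemma cpoly_V: "z\<^sup>2 \<noteq> 1 \<Longrightarrow> cpoly V z = (1 - z\<^sup>2)\<^sup>2 * v_deriv \<alpha> t z"
  by (simp add: v_deriv_eq V_def) (simp add: power2_eq_square algebra_simps)

lemma cpoly_one_minus_sq: "cpoly one_minus_sq z = 1 - z\<^sup>2"
  by (simp add: power2_eq_square)

lemma complex_ladder:
  assumes "z\<^sup>2 \<noteq> 1"
  shows "cpoly (pderiv (P n)) z = of_real (\<beta> n) * ladder_A \<alpha> t P n z * cpoly (P (n - 1)) z
    - ladder_B \<alpha> t P n z * cpoly (P n) z"
proof -
  have "(1 - z\<^sup>2)\<^sup>2 * cpoly (pderiv (P n)) z = (1 - z\<^sup>2)\<^sup>2 *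
    (of_real (\<beta> n) * ladder_A \<alpha> t P n z * cpoly (P (n - 1)) z - ladder_B \<alpha> t P n z * cpoly (P n) z)"
    using arg_cong[OF ladder[of n], of "\<lambda>p. cpoly p z"]
    by (simp only: cpoly_mult cpoly_diff cpoly_smult power2_eq_square[of one_minus_sq]
        cpoly_one_minus_sq cpoly_A[OF assms] cpoly_B[OF assms]) (simp add: power2_eq_square algebra_simps)
  then show ?thesis using assms by simp
qed

lemma complex_ladder_raising:
  assumes "z\<^sup>2 \<noteq> 1"
  shows "of_real (\<beta> n) * cpoly (pderiv (P (n - 1))) z = of_real (\<beta> n) *
    ((ladder_B \<alpha> t P n z + v_deriv \<alpha> t z) * cpoly (P (n - 1)) z - ladder_A \<alpha> t P (n - 1) z * cpoly (P n) z)"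
proof -
  have "(1 - z\<^sup>2)\<^sup>2 * (of_real (\<beta> n) * cpoly (pderiv (P (n - 1))) z) = (1 - z\<^sup>2)\<^sup>2 * (of_real (\<beta> n) *
    ((ladder_B \<alpha> t P n z + v_deriv \<alpha> t z) * cpoly (P (n - 1)) z - ladder_A \<alpha> t P (n - 1) z * cpoly (P n) z))"
    using arg_cong[OF ladder_raising[of n], of "\<lambda>p. cpoly p z"]
    by (simp only: cpoly_mult cpoly_add cpoly_diff cpoly_smult power2_eq_square[of one_minus_sq]
        cpoly_one_minus_sq cpoly_A[OF assms] cpoly_B[OF assms] cpoly_V[OF assms])
      (simp add: power2_eq_square algebra_simps)
  then show ?thesis using assms by simp
qed

lemma complex_compatibility:
  assumes "z\<^sup>2 \<noteq> 1"
  shows "(ladder_B \<alpha> t P n z)\<^sup>2 + v_deriv \<alpha> t z * ladder_B \<alpha> t P n z + (\<Sum>j<n. ladder_A \<alpha> t P j z)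
    = of_real (\<beta> n) * ladder_A \<alpha> t P n z * ladder_A \<alpha> t P (n - 1) z"
proof -
  define q where "q = (1 - z\<^sup>2)\<^sup>2"
  have "q\<^sup>2 * ((ladder_B \<alpha> t P n z)\<^sup>2 + v_deriv \<alpha> t z * ladder_B \<alpha> t P n z + (\<Sum>j<n. ladder_A \<alpha> t P j z))
    = q\<^sup>2 * (of_real (\<beta> n) * ladder_A \<alpha> t P n z * ladder_A \<alpha> t P (n - 1) z)"
    using arg_cong[OF compatibility_2'[of n], of "\<lambda>p. cpoly p z"]
    by (simp only: cpoly_mult cpoly_add cpoly_sum cpoly_smult power2_eq_square[of one_minus_sq]
        power2_eq_square[of "B n"] cpoly_one_minus_sq cpoly_A[OF assms] cpoly_B[OF assms]
        cpoly_V[OF assms] power2_eq_square[of "1 - z\<^sup>2", symmetric] q_def[symmetric]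
        sum_distrib_left[symmetric]) (simp add: power2_eq_square algebra_simps)
  then show ?thesis using assms by (simp add: q_def)
qed

text \<open>Differentiation under the integral is avoided: on an open set around z the functions
  agree with their closed forms.\<close>

lemma ladder_differentiable:
  assumes "z\<^sup>2 \<noteq> 1"
  shows "(ladder_A \<alpha> t P n has_field_derivative deriv (ladder_A \<alpha> t P n) z) (at z)"
    and "(ladder_B \<alpha> t P n has_field_derivative deriv (ladder_B \<alpha> t P n) z) (at z)"
proof -
  have op: "open {w::complex. w\<^sup>2 \<noteq> 1}"
    by (intro open_Collect_neq continuous_intros)
  have "(\<lambda>w. of_real (a n) / (1 - w\<^sup>2) + of_real (R n) / (1 - w\<^sup>2)\<^sup>2) field_differentiable at z"
    using assms by (intro derivative_intros) auto
  then obtain D where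
    "((\<lambda>w. of_real (a n) / (1 - w\<^sup>2) + of_real (R n) / (1 - w\<^sup>2)\<^sup>2) has_field_derivative D) (at z)"
    unfolding field_differentiable_def by blast
  then have "(ladder_A \<alpha> t P n has_field_derivative D) (at z)"
    by (rule has_field_derivative_transform_within_open[OF _ op])
      (use assms in \<open>auto simp: ladder_A_eq\<close>)
  then show "(ladder_A \<alpha> t P n has_field_derivative deriv (ladder_A \<alpha> t P n) z) (at z)"
    by (metis DERIV_imp_deriv)
  have "(\<lambda>w. of_nat n * w / (1 - w\<^sup>2) + w * of_real (r n) / (1 - w\<^sup>2)\<^sup>2) field_differentiable at z"
    using assms by (intro derivative_intros) auto
  then obtain D where
    "((\<lambda>w. of_nat n * w / (1 - w\<^sup>2) + w * of_real (r n) / (1 - w\<^sup>2)\<^sup>2) has_field_derivative D) (at z)"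
    unfolding field_differentiable_def by blast
  then have "(ladder_B \<alpha> t P n has_field_derivative D) (at z)"
    by (rule has_field_derivative_transform_within_open[OF _ op])
      (use assms in \<open>auto simp: ladder_B_eq\<close>)
  then show "(ladder_B \<alpha> t P n has_field_derivative deriv (ladder_B \<alpha> t P n) z) (at z)"
    by (metis DERIV_imp_deriv)
qed

text \<open>The lowering relation is differentiated and P_(n-1) eliminated. It occurs only together
  with \<beta>_n, so \<beta>_n is never divided by and n = 0 is included.\<close>

lemma differential_equation:
  assumes "z\<^sup>2 \<noteq> 1" and "ladder_A \<alpha> t P n z \<noteq> 0"
  shows "deriv (deriv (cpoly (P n))) z
        - (v_deriv \<alpha> t z + deriv (ladder_A \<alpha> t P n) z / ladder_A \<alpha> t P n z) * deriv (cpoly (P n)) z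
        + (deriv (ladder_B \<alpha> t P n) z
           - ladder_B \<alpha> t P n z * (deriv (ladder_A \<alpha> t P n) z / ladder_A \<alpha> t P n z)
           + (\<Sum>j<n. ladder_A \<alpha> t P j z)) * cpoly (P n) z = 0"
proof -
  let ?A = "ladder_A \<alpha> t P n" and ?B = "ladder_B \<alpha> t P n"
  let ?p = "cpoly (P n)" and ?p' = "cpoly (pderiv (P n))" and ?pm = "cpoly (P (n - 1))"
    and ?qm = "cpoly (pderiv (P (n - 1)))"
  let ?b = "of_real (\<beta> n) :: complex"
  define b A A' B B' v p p' p0 A0 S where "b = ?b" and "A = ?A z" and "A' = deriv ?A z"
    and "B = ?B z" and "B' = deriv ?B z" and "v = v_deriv \<alpha> t z"
    and "p = ?p z" and "p' = ?p' z" and "p0 = ?pm z" and "A0 = ladder_A \<alpha> t P (n - 1) z"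
    and "S = (\<Sum>j<n. ladder_A \<alpha> t P j z)"
  note defs = this
  have op: "open {w::complex. w\<^sup>2 \<noteq> 1}"
    by (intro open_Collect_neq continuous_intros)
  have "((\<lambda>w. ?A w * (?b * ?pm w) - ?B w * ?p w) has_field_derivative
      deriv ?A z * (?b * ?pm z) + ?b * ?qm z * ?A z - (deriv ?B z * ?p z + ?p' z * ?B z)) (at z)"
    by (intro DERIV_diff DERIV_mult DERIV_cmult ladder_differentiable assms(1) cpoly_has_field_derivative)
  \<comment> \<open>The lowering relation holds on an open set, hence may be differentiated at
    z.\<close>
  then have "(?p' has_field_derivative
      deriv ?A z * (?b * ?pm z) + ?b * ?qm z * ?A z - (deriv ?B z * ?p z + ?p' z * ?B z)) (at z)"
    by (rule has_field_derivative_transform_within_open[OF _ op])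
      (use assms(1) in \<open>simp_all add: complex_ladder\<close>)
  then have "cpoly (pderiv (pderiv (P n))) z = deriv ?A z * (?b * ?pm z) + ?b * ?qm z * ?A z - (deriv ?B z * ?p z + ?p' z * ?B z)"
    by (rule DERIV_unique[OF cpoly_has_field_derivative])
  also have "\<dots> = A' * (b * p0) + b * ?qm z * A - (B' * p + p' * B)"
    unfolding defs ..
  also have "b * ?qm z = b * ((B + v) * p0 - A0 * p)"
    unfolding defs by (rule complex_ladder_raising[OF assms(1)])
  finally have p'': "cpoly (pderiv (pderiv (P n))) z =
      A' * (b * p0) + (B + v) * (A * (b * p0)) - (b * A * A0) * p - (B' * p + B * p')"
    by (simp add: algebra_simps)
  have bp0: "A * (b * p0) = p' + B * p"
    using complex_ladder[OF assms(1), of n] by (simp add: defs algebra_simps)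
  then have bp0': "b * p0 = (p' + B * p) / A"
    using assms(2) by (simp add: A_def field_simps)
  have bAA: "b * A * A0 = B\<^sup>2 + v * B + S"
    using complex_compatibility[OF assms(1), of n] by (simp add: defs)
  have "cpoly (pderiv (pderiv (P n))) z =
      A' * ((p' + B * p) / A) + (B + v) * (p' + B * p) - (B\<^sup>2 + v * B + S) * p - (B' * p + B * p')"
    \<comment> \<open>\<open>bp0\<close> first absorbs the product \<open>A * (b * p0)\<close>; the
      A' term then needs the divided form \<open>bp0'\<close>, hence A_n(z) \<noteq> 0.\<close>
    unfolding p'' bp0 bAA unfolding bp0' ..
  then show ?thesis
    unfolding deriv_cpoly defs[symmetric]
    by (simp add: algebra_simps add_divide_distrib power2_eq_square)
qed

end

text \<open>The differential equation is asserted where A_n(z) \<noteq> 0, because A_n' / A_n has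
  poles at the zeros of A_n.\<close>

theorem theorem2p4:
  fixes \<alpha> t :: real and P :: "nat \<Rightarrow> real poly" and n :: nat and z :: complex
  assumes "\<alpha> > 0" and "t > 0"
    and "monic_orthogonal (weight \<alpha> t) P"
    and "z \<noteq> 1" and "z \<noteq> -1"
  shows
    "(ladder_A \<alpha> t P n z \<noteq> 0 \<longrightarrow>
        deriv (deriv (cpoly (P n))) z
        - (v_deriv \<alpha> t z + deriv (ladder_A \<alpha> t P n) z / ladder_A \<alpha> t P n z) * deriv (cpoly (P n)) z
        + (deriv (ladder_B \<alpha> t P n) z
           - ladder_B \<alpha> t P n z * (deriv (ladder_A \<alpha> t P n) z / ladder_A \<alpha> t P n z)
           + (\<Sum>j<n. ladder_A \<alpha> t P j z)) * cpoly (P n) z = 0)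
     \<and> ladder_A \<alpha> t P n z =
         of_real (2 * real n + 1 + 2 * \<alpha>) / (1 - z\<^sup>2)
         + of_real (2 * real n + 1 + 2 * t
             - (2 * real n + 3 + 2 * \<alpha>) * (beta (weight \<alpha> t) P n + beta (weight \<alpha> t) P (n + 1))
             + 4 * subcoeff P n) / (1 - z\<^sup>2)\<^sup>2
     \<and> ladder_B \<alpha> t P n z =
         of_nat n * z / (1 - z\<^sup>2)
         + z * of_real (real n - (2 * real n + 1 + 2 * \<alpha>) * beta (weight \<alpha> t) P n
             + 2 * subcoeff P n) / (1 - z\<^sup>2)\<^sup>2
     \<and> (\<Sum>j<n. ladder_A \<alpha> t P j z) =
         of_real ((real n)\<^sup>2 + 2 * real n * \<alpha>) / (1 - z\<^sup>2)
         + of_real (real n * (real n + 2 * t)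
             - (2 * real n + 1 + 2 * \<alpha>) * beta (weight \<alpha> t) P n
             + 4 * (real n + \<alpha>) * subcoeff P n) / (1 - z\<^sup>2)\<^sup>2
     \<and> v_deriv \<alpha> t z =
         of_real (2 * \<alpha>) * z / (1 - z\<^sup>2) + of_real (2 * t) * z / (1 - z\<^sup>2)\<^sup>2"
proof -
  interpret weight_polynomials \<alpha> t P
    using assms by unfold_locales
  have z: "z\<^sup>2 \<noteq> 1"
    using assms by (simp add: power2_eq_1_iff)
  have "(\<Sum>j<n. ladder_A \<alpha> t P j z) =
      of_real (\<Sum>j<n. a j) / (1 - z\<^sup>2) + of_real (\<Sum>j<n. R j) / (1 - z\<^sup>2)\<^sup>2"
    by (simp add: ladder_A_eq[OF z] sum.distrib sum_divide_distrib)
  note sum = this[unfolded sum_a sum_R]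
  have v: "v_deriv \<alpha> t z = of_real (2 * \<alpha>) * z / (1 - z\<^sup>2) + of_real (2 * t) * z / (1 - z\<^sup>2)\<^sup>2"
    using z by (simp add: v_deriv_eq add_divide_distrib power2_eq_square)
  show ?thesis
    using differential_equation[OF z, of n] ladder_A_eq[OF z, of n] ladder_B_eq[OF z, of n] sum v
    unfolding beta_eq a_def R_def r_def Suc_eq_plus1 by blast
qed

end
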